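(* Let $z_1,\dots,z_J$ be distinct points of the unit circle, $\phi(z)=\prod_{j=1}^J(1-\overline{z_j}z)$, and let $(a_n)_{n\ge0}$ be a sequence of complex numbers with $a_n\ne1$ for all $n$. Let $H(K)$ be the reproducing kernel Hilbert space with orthonormal basis $f_n(z)=z^n\phi(a_nz)$, $n\ge0$, and kernel $K(z,\zeta)=\sum_{n=0}^\infty f_n(z)\overline{f_n(\zeta)}$. If $p>1/2$ and $\lim_{n\to\infty}n(1-a_n)=p$, then $$H(K)=\phi(z)H^2(\mathbb{D})+\mathbb{C}K(z,z_1)+\mathbb{C}K(z,z_2)+\cdots+\mathbb{C}K(z,z_J).$$
   Context: $J\ge1$ is an integer. The elements of $H(K)$ are the functions $f=\sum_n\alpha_nf_n$ with $(\alpha_n)\in\ell^2$ and $\|f\|=\|(\alpha_n)\|_{\ell^2}$; they are defined on $\mathbb{D}\cup\{z_1,\dots,z_J\}$ (where $\sum_n|f_n(z)|^2<\infty$) and analytic on the open unit disc $\mathbb{D}$. $K(z,z_j)$ is regarded as a function of $z$, $H^2(\mathbb{D})$ is the Hardy space, and $\phi(z)H^2(\mathbb{D})=\{\phi g:g\in H^2(\mathbb{D})\}$. The equality is an equality of sets of functions on $\mathbb{D}$, elements of $H(K)$ being identified with their restrictions to $\mathbb{D}$. *)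

theory Defs
  imports "HOL-Complex_Analysis.Complex_Analysis"
begin

definition phi :: "nat \<Rightarrow> (nat \<Rightarrow> complex) \<Rightarrow> complex \<Rightarrow> complex" where
  "phi J z w = (\<Prod>j=1..J. (1 - cnj (z j) * w))"

definition basis_fun ::
  "nat \<Rightarrow> (nat \<Rightarrow> complex) \<Rightarrow> (nat \<Rightarrow> complex) \<Rightarrow> nat \<Rightarrow> complex \<Rightarrow> complex" where
  "basis_fun J z a n w = w ^ n * phi J z (a n * w)"

(* The reproducing kernel with orthonormal basis f. Both this series and the one in rk_space
   converge absolutely, by Cauchy-Schwarz, at points where the squares of the moduli of the
   f n are summable. *)
definition rkernel :: "(nat \<Rightarrow> complex \<Rightarrow> complex) \<Rightarrow> complex \<Rightarrow> complex \<Rightarrow> complex" where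
  "rkernel f w \<zeta> = (\<Sum>n. f n w * cnj (f n \<zeta>))"

(* The elements of the reproducing kernel Hilbert space on X with orthonormal basis f, as functions
   that are undefined off X. The norm of such an element is the l2-norm of \<alpha>; only the
   underlying set of functions is defined here. *)
definition rk_space ::
  "complex set \<Rightarrow> (nat \<Rightarrow> complex \<Rightarrow> complex) \<Rightarrow> (complex \<Rightarrow> complex) set" where
  "rk_space X f =
     {(\<lambda>w\<in>X. \<Sum>n. \<alpha> n * f n w) | \<alpha> :: nat \<Rightarrow> complex. summable (\<lambda>n. (cmod (\<alpha> n))\<^sup>2)}"

(* The Hardy space on the open unit disc, defined by bounded integral means. Its members are total
   functions whose values off the disc are irrelevant. *)
definition hardy2 :: "(complex \<Rightarrow> complex) set" where
  "hardy2 = {g. g holomorphic_on ball 0 1 \<and>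
     bdd_above ((\<lambda>r. 1 / (2 * pi) * integral {0..2 * pi} (\<lambda>t. (cmod (g (of_real r * cis t)))\<^sup>2)) ` {0<..<1})}"

end

theory Submission
  imports Defs "HOL-Real_Asymp.Real_Asymp"
begin

text \<open>
  Write \<open>f n\<close> for the basis functions, \<open>\<phi>\<close> for \<open>phi J z\<close> and \<open>D j\<close> for the product of the factors
  \<open>1 - cnj (z i) * z j\<close> over \<open>i \<noteq> j\<close>. Inside \<open>H(K)\<close>, the functions vanishing at all
  nodes \<open>z j\<close> are exactly the multiples \<open>\<phi> g\<close> with \<open>g\<close> in the Hardy space, and the kernels
  \<open>K(\<cdot>, z j)\<close> span the orthogonal complement of the former: orthogonality to \<open>K(\<cdot>, z j)\<close> means
  vanishing at \<open>z j\<close>. Since \<open>f n (z j)\<close> is of order \<open>1 / n\<close>, evaluation at a node is a bounded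
  functional, and \<open>ell2_projection_exists\<close> provides the projection onto the span of the kernels.

  Everything is expressed in coefficients, the Hardy space being the space of power series with
  square-summable coefficients (\<open>ell2_power_series_in_hardy2\<close>, \<open>hardy2_taylor_ell2\<close>). Lagrange
  interpolation of \<open>w \<mapsto> \<phi> (a * w)\<close> at the points \<open>0, z 1, \<dots>, z J\<close> (\<open>phi_interpolation\<close>)
  leads to the formula, valid for every square-summable \<open>\<alpha>\<close>,
  \<open>(\<Sum>n. \<alpha> n * f n w) = \<phi> w * (\<Sum>m. g m * w ^ m)\<close>, where
  \<open>g m = \<alpha> m + (\<Sum>j=1..J. cnj (z j) ^ m / D j * S j m)\<close> and \<open>S j m = (\<Sum>n<m. \<alpha> n * f n (z j))\<close>
  (\<open>basis_series_eq_phi_times_quotient\<close>). So two things have to be shown about the map sending \<open>\<alpha>\<close> to \<open>g\<close>.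

  If the function vanishes at all nodes, then \<open>S j m\<close> is minus a tail of a series with terms
  bounded by a multiple of \<open>\<bar>\<alpha> n\<bar> / n\<close>, so the dual Hardy inequality \<open>hardy_tail_summable\<close> makes \<open>g\<close>
  square-summable (\<open>quotient_coeff_ell2\<close>).

  Conversely, given a square-summable \<open>g\<close>, the formula determines \<open>\<alpha>\<close> recursively
  (\<open>quotient_coeff_surj\<close>). The normalised partial sums \<open>s j m = S j m / D j\<close> obey
  \<open>s j (m + 1) = s j m + z j ^ m * (p + o(1)) / m * (g m - (\<Sum>i=1..J. cnj (z i) ^ m * s i m))\<close>.
  The term with \<open>i = j\<close> damps \<open>s j\<close> by the factor \<open>1 - p / m\<close>; the other terms carry the
  oscillating factors \<open>(z j * cnj (z i)) ^ m\<close>, and a change of variables that differs from the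
  identity by \<open>O(1 / m)\<close> removes them up to errors of lower order (\<open>oscillating_system_ell2\<close>). What remains is a
  scalar inequality \<open>x (m + 1) \<le> (1 - q / m) * x m + C / m * y m\<close> in which every \<open>q < p\<close> may be
  taken. Solutions of the homogeneous recursion decay like the power \<open>-q\<close> of \<open>m\<close>, which is
  square-summable if and only if \<open>q > 1 / 2\<close>; this is where \<open>p > 1 / 2\<close> enters
  (\<open>weighted_decay_summable\<close>).
\<close>

section \<open>Square-summable sequences and orthogonal projection\<close>

abbreviation ell2 :: "(nat \<Rightarrow> complex) \<Rightarrow> bool" where
  "ell2 \<alpha> \<equiv> summable (\<lambda>n. (cmod (\<alpha> n))\<^sup>2)"

lemma ell2_summable_mult:
  fixes \<alpha> \<beta> :: "nat \<Rightarrow> complex"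
  assumes "ell2 \<alpha>" "ell2 \<beta>"
  shows "summable (\<lambda>n. \<alpha> n * \<beta> n)"
proof (rule summable_norm_cancel, rule summable_comparison_test')
  show "summable (\<lambda>n. (cmod (\<alpha> n))\<^sup>2 + (cmod (\<beta> n))\<^sup>2)"
    using assms by (rule summable_add)
  show "norm (norm (\<alpha> n * \<beta> n)) \<le> (cmod (\<alpha> n))\<^sup>2 + (cmod (\<beta> n))\<^sup>2" for n
  proof -
    have "2 * (cmod (\<alpha> n) * cmod (\<beta> n)) \<le> (cmod (\<alpha> n))\<^sup>2 + (cmod (\<beta> n))\<^sup>2"
      using sum_squares_bound[of "cmod (\<alpha> n)" "cmod (\<beta> n)"] by (simp add: mult.assoc)
    moreover have "0 \<le> cmod (\<alpha> n) * cmod (\<beta> n)" by simp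
    ultimately show ?thesis by (simp only: norm_mult real_norm_def abs_mult abs_norm_cancel)
  qed
qed

lemma ell2_add:
  assumes "ell2 \<alpha>" "ell2 \<beta>"
  shows "ell2 (\<lambda>n. \<alpha> n + \<beta> n)"
proof (rule summable_comparison_test')
  show "summable (\<lambda>n. 2 * ((cmod (\<alpha> n))\<^sup>2 + (cmod (\<beta> n))\<^sup>2))"
    using assms by (intro summable_mult summable_add)
  fix n
  have "(cmod (\<alpha> n + \<beta> n))\<^sup>2 \<le> (cmod (\<alpha> n) + cmod (\<beta> n))\<^sup>2"
    by (intro power_mono norm_triangle_ineq) auto
  also have "\<dots> \<le> 2 * ((cmod (\<alpha> n))\<^sup>2 + (cmod (\<beta> n))\<^sup>2)"
    using sum_squares_bound[of "cmod (\<alpha> n)" "cmod (\<beta> n)"] by (simp add: power2_sum)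
  finally show "norm ((cmod (\<alpha> n + \<beta> n))\<^sup>2) \<le> 2 * ((cmod (\<alpha> n))\<^sup>2 + (cmod (\<beta> n))\<^sup>2)"
    by simp
qed

lemma ell2_cmult: "ell2 \<alpha> \<Longrightarrow> ell2 (\<lambda>n. c * \<alpha> n)"
  by (simp add: norm_mult power_mult_distrib summable_mult)

lemma ell2_diff: "ell2 \<alpha> \<Longrightarrow> ell2 \<beta> \<Longrightarrow> ell2 (\<lambda>n. \<alpha> n - \<beta> n)"
  using ell2_add[of \<alpha> "\<lambda>n. - \<beta> n"] by simp

lemma ell2_sum: "(\<And>i. i \<in> I \<Longrightarrow> ell2 (\<alpha> i)) \<Longrightarrow> ell2 (\<lambda>n. \<Sum>i\<in>I. \<alpha> i n)"
  by (induction I rule: infinite_finite_induct) (auto intro: ell2_add)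

lemma ell2_le:
  assumes "\<forall>\<^sub>F n in sequentially. cmod (\<alpha> n) \<le> x n" "summable (\<lambda>n. (x n)\<^sup>2)"
  shows "ell2 \<alpha>"
proof (rule summable_comparison_test_ev[OF _ assms(2)])
  show "\<forall>\<^sub>F n in sequentially. norm ((cmod (\<alpha> n))\<^sup>2) \<le> (x n)\<^sup>2"
    using assms(1) by eventually_elim (simp add: power_mono)
qed

lemma ell2_inner_self_eq_0:
  assumes "ell2 u" "(\<Sum>n. u n * cnj (u n)) = 0"
  shows "u n = 0"
proof -
  have "(\<Sum>n. u n * cnj (u n)) = of_real (\<Sum>n. (cmod (u n))\<^sup>2)"
    by (simp only: complex_norm_square[symmetric] suminf_of_real[OF assms(1)])
  then have "(\<Sum>n. (cmod (u n))\<^sup>2) = 0" using assms(2) by (metis of_real_eq_0_iff)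
  then show ?thesis
    using suminf_eq_zero_iff[OF assms(1)] by simp
qed

text \<open>Gram--Schmidt, one vector at a time: the new vector is first made orthogonal to the earlier ones.
If nothing remains of it, it already lies in their span and contributes nothing.\<close>

lemma ell2_projection_exists:
  fixes v :: "'i \<Rightarrow> nat \<Rightarrow> complex"
  assumes "finite I" "\<And>i. i \<in> I \<Longrightarrow> ell2 (v i)" "ell2 \<alpha>"
  shows "\<exists>c. \<forall>j\<in>I. (\<Sum>n. (\<alpha> n - (\<Sum>i\<in>I. c i * v i n)) * cnj (v j n)) = 0"
  using assms
proof (induction I arbitrary: \<alpha> rule: finite_induct)
  case empty
  then show ?case by simp
next
  case (insert k I)
  have vI: "\<And>i. i \<in> I \<Longrightarrow> ell2 (v i)" and vk: "ell2 (v k)" using insert.prems by auto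
  obtain c where c: "\<forall>j\<in>I. (\<Sum>n. (\<alpha> n - (\<Sum>i\<in>I. c i * v i n)) * cnj (v j n)) = 0"
    using insert.IH[OF vI insert.prems(2)] by blast
  obtain d where d: "\<forall>j\<in>I. (\<Sum>n. (v k n - (\<Sum>i\<in>I. d i * v i n)) * cnj (v j n)) = 0"
    using insert.IH[OF vI vk] by blast
  define \<beta> where "\<beta> n = \<alpha> n - (\<Sum>i\<in>I. c i * v i n)" for n
  define u where "u n = v k n - (\<Sum>i\<in>I. d i * v i n)" for n
  have \<beta>: "ell2 \<beta>" unfolding \<beta>_def
    by (intro ell2_diff ell2_sum ell2_cmult vI insert.prems)
  have u: "ell2 u" unfolding u_def
    by (intro ell2_diff ell2_sum ell2_cmult vI vk)
  \<comment> \<open>If \<open>u = 0\<close>, both inner products vanish and \<open>e = 0\<close> because division by zero yields zero.\<close>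
  define e where "e = (\<Sum>n. \<beta> n * cnj (u n)) / (\<Sum>n. u n * cnj (u n))"
  have S: "summable (\<lambda>n. x n * cnj (y n))" if "ell2 x" "ell2 y" for x y
    using ell2_summable_mult[of x "\<lambda>n. cnj (y n)"] that by simp
  have eu: "(\<Sum>n. \<beta> n * cnj (u n)) - e * (\<Sum>n. u n * cnj (u n)) = 0"
  proof (cases "(\<Sum>n. u n * cnj (u n)) = 0")
    case True
    then have "\<And>n. u n = 0" using ell2_inner_self_eq_0[OF u] by blast
    then show ?thesis by simp
  qed (simp add: e_def)
  have split: "(\<Sum>n. (\<beta> n - e * u n) * cnj (y n)) =
      (\<Sum>n. \<beta> n * cnj (y n)) - e * (\<Sum>n. u n * cnj (y n))" if "ell2 y" for y
  proof -
    have "(\<Sum>n. (\<beta> n - e * u n) * cnj (y n)) = (\<Sum>n. \<beta> n * cnj (y n) - e * (u n * cnj (y n)))"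
      by (simp add: algebra_simps)
    also have "\<dots> = (\<Sum>n. \<beta> n * cnj (y n)) - (\<Sum>n. e * (u n * cnj (y n)))"
      by (intro suminf_diff[symmetric] summable_mult S \<beta> u that)
    also have "(\<Sum>n. e * (u n * cnj (y n))) = e * (\<Sum>n. u n * cnj (y n))"
      by (intro suminf_mult S u that)
    finally show ?thesis .
  qed
  have I0: "(\<Sum>n. (\<beta> n - e * u n) * cnj (v j n)) = 0" if "j \<in> I" for j
    using split[OF vI[OF that]] bspec[OF c that] bspec[OF d that]
    unfolding \<beta>_def[symmetric] u_def[symmetric] by simp
  have u0: "(\<Sum>n. (\<beta> n - e * u n) * cnj (u n)) = 0"
    using eu by (simp add: split u)
  have r: "ell2 (\<lambda>n. \<beta> n - e * u n)" by (intro ell2_diff ell2_cmult \<beta> u)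
  have k0: "(\<Sum>n. (\<beta> n - e * u n) * cnj (v k n)) = 0"
  proof -
    have vu: "v k n = u n + (\<Sum>i\<in>I. d i * v i n)" for n by (simp add: u_def)
    have "(\<Sum>n. (\<beta> n - e * u n) * cnj (v k n)) =
      (\<Sum>n. (\<beta> n - e * u n) * cnj (u n) + (\<Sum>i\<in>I. cnj (d i) * ((\<beta> n - e * u n) * cnj (v i n))))"
      unfolding vu by (simp add: sum_distrib_left ring_distribs mult_ac)
    also have "\<dots> = (\<Sum>n. (\<beta> n - e * u n) * cnj (u n)) +
        (\<Sum>n. \<Sum>i\<in>I. cnj (d i) * ((\<beta> n - e * u n) * cnj (v i n)))"
      by (intro suminf_add[symmetric] summable_sum summable_mult S r u vI)
    also have "(\<Sum>n. \<Sum>i\<in>I. cnj (d i) * ((\<beta> n - e * u n) * cnj (v i n))) =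
        (\<Sum>i\<in>I. \<Sum>n. cnj (d i) * ((\<beta> n - e * u n) * cnj (v i n)))"
      by (intro suminf_sum summable_mult S r vI)
    also have "\<dots> = (\<Sum>i\<in>I. 0)"
    proof (intro sum.cong refl)
      fix i assume "i \<in> I"
      show "(\<Sum>n. cnj (d i) * ((\<beta> n - e * u n) * cnj (v i n))) = 0"
        unfolding suminf_mult[OF S[OF r vI[OF \<open>i \<in> I\<close>]]] I0[OF \<open>i \<in> I\<close>] by simp
    qed
    finally show ?thesis using u0 by simp
  qed
  define c' where "c' i = (if i = k then e else c i - e * d i)" for i
  have "\<alpha> n - (\<Sum>i\<in>insert k I. c' i * v i n) = \<beta> n - e * u n" for n
  proof -
    have "(\<Sum>i\<in>I. c' i * v i n) = (\<Sum>i\<in>I. (c i - e * d i) * v i n)"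
      using insert.hyps by (intro sum.cong) (auto simp: c'_def)
    also have "\<dots> = (\<Sum>i\<in>I. c i * v i n) - e * (\<Sum>i\<in>I. d i * v i n)"
      by (simp add: algebra_simps sum_subtractf sum_distrib_left)
    finally show ?thesis
      using insert.hyps by (simp add: \<beta>_def u_def c'_def algebra_simps)
  qed
  then have "(\<Sum>n. (\<alpha> n - (\<Sum>i\<in>insert k I. c' i * v i n)) * cnj (v j n)) = 0"
    if "j \<in> insert k I" for j
    using that I0 k0 by (cases "j = k") (simp_all only:, blast)
  then show ?case by blast
qed

lemma summable_power_series_Bseq:
  fixes c :: "nat \<Rightarrow> complex"
  assumes "Bseq c" "cmod w < 1"
  shows "summable (\<lambda>n. c n * w ^ n)"
proof -
  obtain K where K: "\<And>n. cmod (c n) \<le> K" using assms(1) unfolding Bseq_def by blast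
  show ?thesis
  proof (rule summable_comparison_test')
    show "summable (\<lambda>n. K * cmod w ^ n)"
      using assms(2) by (intro summable_mult summable_geometric) simp
    show "norm (c n * w ^ n) \<le> K * cmod w ^ n" for n
      using K[of n] by (simp add: norm_mult norm_power mult_right_mono)
  qed
qed

lemma ell2_imp_Bseq:
  assumes "ell2 \<alpha>" shows "Bseq \<alpha>"
proof -
  have "(\<lambda>n. (cmod (\<alpha> n))\<^sup>2) \<longlonglongrightarrow> 0" using assms by (rule summable_LIMSEQ_zero)
  then have "(\<lambda>n. sqrt ((cmod (\<alpha> n))\<^sup>2)) \<longlonglongrightarrow> sqrt 0" by (rule tendsto_real_sqrt)
  then have "\<alpha> \<longlonglongrightarrow> 0" by (simp add: tendsto_norm_zero_iff)
  then show ?thesis using convergent_imp_Bseq convergent_def by blast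
qed

text \<open>Summation by parts: multiplying a generating function by \<open>1 - x\<close> takes differences of its
coefficients.\<close>

lemma sums_difference_power_series:
  fixes s :: "nat \<Rightarrow> 'a :: real_normed_field"
  assumes "s 0 = 0" "(\<lambda>m. s m * x ^ m) sums \<sigma>"
  shows "(\<lambda>m. (s (Suc m) - s m) * x ^ Suc m) sums ((1 - x) * \<sigma>)"
proof -
  have "(\<lambda>m. s (Suc m) * x ^ Suc m) sums \<sigma>"
    using assms sums_Suc_iff[of "\<lambda>m. s m * x ^ m" \<sigma>] by simp
  from sums_diff[OF this sums_mult[OF assms(2), of x]] show ?thesis
    by (simp add: algebra_simps)
qed

section \<open>Two inequalities of Hardy type\<close>

text \<open>Unrolling the recursion would lead to Hardy's inequality with the weight \<open>m powr (-q)\<close>. The energy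
\<open>m * (x m)\<^sup>2\<close> avoids the unrolling: since \<open>(m + 1) * (1 - q / m)\<^sup>2\<close> is \<open>m - (2 * q - 1) + O(1 / m)\<close>,
each step loses a fixed multiple of \<open>(x m)\<^sup>2\<close> from the energy when \<open>q > 1 / 2\<close>, and
gains at most a multiple of \<open>(y m)\<^sup>2\<close>; summing the steps bounds the sum of \<open>(x m)\<^sup>2\<close>.\<close>

lemma weighted_decay_summable:
  fixes x y :: "nat \<Rightarrow> real"
  assumes q: "q > 1 / 2"
    and x: "\<And>m. x m \<ge> 0"
    and rec: "\<forall>\<^sub>F m in sequentially. x (Suc m) \<le> (1 - q / m) * x m + C / m * y m"
    and y: "summable (\<lambda>m. (y m)\<^sup>2)"
  shows "summable (\<lambda>m. (x m)\<^sup>2)"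
proof -
  define \<delta> where "\<delta> = q - 1 / 2"
  have \<delta>: "\<delta> > 0" using q by (simp add: \<delta>_def)
  \<comment> \<open>The square of the two-term bound is split by Young's inequality with weight \<open>\<delta> / m\<close>, which costs
    only \<open>\<delta>\<close> out of the gain \<open>2 * q - 1 = 2 * \<delta>\<close>.\<close>
  define L where "L = 2 * (1 + 1 / \<delta>) * C\<^sup>2"
  have cond: "\<forall>\<^sub>F m in sequentially. (real m + 1) * (1 + \<delta> / m) * (1 - q / m)\<^sup>2 \<le> m - \<delta> / 2"
  proof -
    have "(\<lambda>m. (real m + 1) * (1 + \<delta> / m) * (1 - q / m)\<^sup>2 - m) \<longlonglongrightarrow> 1 + \<delta> - 2 * q"
      by real_asymp
    moreover have "1 + \<delta> - 2 * q < - \<delta> / 2" using \<delta> by (simp add: \<delta>_def)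
    ultimately have "\<forall>\<^sub>F m in sequentially.
        (real m + 1) * (1 + \<delta> / m) * (1 - q / m)\<^sup>2 - m < - \<delta> / 2"
      by (rule order_tendstoD(2))
    then show ?thesis by eventually_elim simp
  qed
  have "\<forall>\<^sub>F m in sequentially. real (Suc m) * (x (Suc m))\<^sup>2 \<le> real m * (x m)\<^sup>2 - \<delta> / 2 * (x m)\<^sup>2 + L * (y m)\<^sup>2"
    using rec cond eventually_ge_at_top[of 1]
  proof eventually_elim
    case (elim m)
    define A B where "A = (1 - q / m) * x m" and "B = C / m * y m"
    have m: "real m \<ge> 1" using elim by simp
    have young: "(A + B)\<^sup>2 \<le> (1 + \<delta> / m) * A\<^sup>2 + (1 + m / \<delta>) * B\<^sup>2"
    proof -
      have "0 \<le> (\<delta> * A - m * B)\<^sup>2 / (m * \<delta>)" using m \<delta> by simp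
      also have "\<dots> = (1 + \<delta> / m) * A\<^sup>2 + (1 + m / \<delta>) * B\<^sup>2 - (A + B)\<^sup>2"
        using m \<delta> by (simp add: field_simps power2_eq_square)
      finally show ?thesis by simp
    qed
    have "(x (Suc m))\<^sup>2 \<le> (A + B)\<^sup>2"
      using elim x[of "Suc m"] by (intro power_mono) (auto simp: A_def B_def)
    then have "(m + 1) * (x (Suc m))\<^sup>2 \<le> (m + 1) * ((1 + \<delta> / m) * A\<^sup>2 + (1 + m / \<delta>) * B\<^sup>2)"
      using young by (intro mult_left_mono) auto
    also have "\<dots> = ((real m + 1) * (1 + \<delta> / m) * (1 - q / m)\<^sup>2) * (x m)\<^sup>2 + (m + 1) * (1 + m / \<delta>) * B\<^sup>2"
      unfolding A_def power_mult_distrib by (simp add: ring_distribs mult_ac add.commute)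
    also have "(m + 1) * (1 + m / \<delta>) * B\<^sup>2 \<le> L * (y m)\<^sup>2"
    proof -
      have "real (m + 1) \<le> 2 * m" using m by simp
      moreover have "1 + m / \<delta> \<le> m * (1 + 1 / \<delta>)" using m by (simp add: algebra_simps)
      ultimately have "(m + 1) * (1 + m / \<delta>) \<le> (2 * m) * (m * (1 + 1 / \<delta>))"
        using m \<delta> by (intro mult_mono) auto
      then have "(m + 1) * (1 + m / \<delta>) * B\<^sup>2 \<le> (2 * m) * (m * (1 + 1 / \<delta>)) * B\<^sup>2"
        by (rule mult_right_mono) simp
      also have "\<dots> = L * (y m)\<^sup>2" using m by (simp add: L_def B_def power2_eq_square)
      finally show ?thesis .
    qed
    also have "((real m + 1) * (1 + \<delta> / m) * (1 - q / m)\<^sup>2) * (x m)\<^sup>2 \<le> (m - \<delta> / 2) * (x m)\<^sup>2"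
      using elim by (intro mult_right_mono) auto
    finally show ?case by (simp add: algebra_simps)
  qed
  then obtain M where M: "\<And>m. m \<ge> M \<Longrightarrow>
      real (Suc m) * (x (Suc m))\<^sup>2 \<le> real m * (x m)\<^sup>2 - \<delta> / 2 * (x m)\<^sup>2 + L * (y m)\<^sup>2"
    unfolding eventually_sequentially by blast
  have L: "L \<ge> 0" using \<delta> by (simp add: L_def)
  have tel: "\<delta> / 2 * (\<Sum>k<N. (x (k + M))\<^sup>2) + real (N + M) * (x (N + M))\<^sup>2
      \<le> M * (x M)\<^sup>2 + L * (\<Sum>k<N. (y (k + M))\<^sup>2)" for N
  proof (induction N)
    case (Suc N)
    then show ?case using M[of "N + M"] by (simp add: algebra_simps)
  qed simp
  have "summable (\<lambda>k. (x (k + M))\<^sup>2)"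
  proof (rule bounded_imp_summable)
    fix N
    have yM: "summable (\<lambda>k. (y (k + M))\<^sup>2)"
      using y summable_iff_shift[of "\<lambda>k. (y k)\<^sup>2" M] by simp
    have "\<delta> / 2 * (\<Sum>k<Suc N. (x (k + M))\<^sup>2) \<le> M * (x M)\<^sup>2 + L * (\<Sum>k<Suc N. (y (k + M))\<^sup>2)"
    proof -
      have "0 \<le> real (Suc N + M) * (x (Suc N + M))\<^sup>2" by simp
      then show ?thesis using tel[of "Suc N"] by linarith
    qed
    also have "\<dots> \<le> M * (x M)\<^sup>2 + L * (\<Sum>k. (y (k + M))\<^sup>2)"
      using L by (intro add_left_mono mult_left_mono sum_le_suminf yM) auto
    finally show "(\<Sum>k\<le>N. (x (k + M))\<^sup>2) \<le> (M * (x M)\<^sup>2 + L * (\<Sum>k. (y (k + M))\<^sup>2)) / (\<delta> / 2)"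
      using \<delta> by (simp add: lessThan_Suc_atMost field_simps)
  qed simp
  then show ?thesis using summable_iff_shift[of "\<lambda>k. (x k)\<^sup>2" M] by simp
qed

text \<open>The second part says that the adjoint of the Cesaro operator is bounded on square-summable
sequences. As above it is proved by an energy: for the tails \<open>Y m\<close>, the increment of
\<open>m * (Y m)\<^sup>2\<close> is at least \<open>(Y m)\<^sup>2 / 2 - 2 * (x m)\<^sup>2\<close>. The tails are cut off at \<open>N\<close>, so that the telescoping sum
has no boundary terms, and \<open>N\<close> tends to infinity only at the end.\<close>

lemma hardy_tail_summable:
  fixes x :: "nat \<Rightarrow> real"
  assumes x: "\<And>n. x n \<ge> 0" and x2: "summable (\<lambda>n. (x n)\<^sup>2)"
  shows "summable (\<lambda>n. x n / Suc n)" "summable (\<lambda>m. (\<Sum>n. x (n + m) / Suc (n + m))\<^sup>2)"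
proof -
  show sm: "summable (\<lambda>n. x n / Suc n)"
  proof (rule summable_comparison_test')
    show "summable (\<lambda>n. (x n)\<^sup>2 + (1 / (real (Suc n))^2))"
      using x2 inverse_power_summable[of 2, where 'a = real]
      by (intro summable_add) (auto simp: inverse_eq_divide power_one_over summable_Suc_iff[of "\<lambda>n. 1 / (real n)\<^sup>2"] simp del: of_nat_Suc)
    show "norm (x n / Suc n) \<le> (x n)\<^sup>2 + (1 / (real (Suc n))^2)" for n
    proof -
      have "2 * (x n / Suc n) \<le> (x n)\<^sup>2 + 1 / (real (Suc n))^2"
        using sum_squares_bound[of "x n" "1 / real (Suc n)"] by (simp add: power_one_over)
      moreover have "0 \<le> x n / Suc n" using x by simp
      ultimately show ?thesis by simp
    qed
  qed
  define X where "X = (\<Sum>n. (x n)\<^sup>2)"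
  define Y where "Y N m = (\<Sum>n=m..<N. x n / Suc n)" for N m
  have Y0: "Y N m \<ge> 0" for N m unfolding Y_def using x by (intro sum_nonneg) auto
  have YS: "Y N m = x m / Suc m + Y N (Suc m)" if "m < N" for N m
    using that unfolding Y_def by (simp add: sum.atLeast_Suc_lessThan)
  have step: "(Y N m)\<^sup>2 / 2 - 2 * (x m)\<^sup>2 \<le> real (Suc m) * (Y N (Suc m))\<^sup>2 - m * (Y N m)\<^sup>2"
    if "m < N" for N m
  proof -
    define d where "d = x m / Suc m"
    have d: "real (Suc m) * d = x m" "d \<ge> 0" using x by (simp_all add: d_def del: of_nat_Suc)
    have e: "Y N (Suc m) = Y N m - d" using YS[OF that] by (simp add: d_def)
    have "real (Suc m) * (Y N (Suc m))\<^sup>2 - m * (Y N m)\<^sup>2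
        = (Y N m)\<^sup>2 - 2 * (real (Suc m) * d) * Y N m + real (Suc m) * d\<^sup>2"
      unfolding e by (simp add: algebra_simps power2_eq_square)
    also have "\<dots> \<ge> (Y N m)\<^sup>2 - 2 * x m * Y N m" unfolding d(1) by simp
    finally have "(Y N m)\<^sup>2 - 2 * x m * Y N m \<le> real (Suc m) * (Y N (Suc m))\<^sup>2 - m * (Y N m)\<^sup>2" .
    moreover have "0 \<le> (Y N m - 2 * x m)\<^sup>2 / 2" by simp
    then have "(Y N m)\<^sup>2 / 2 - 2 * (x m)\<^sup>2 \<le> (Y N m)\<^sup>2 - 2 * x m * Y N m"
      by (simp add: power2_eq_square algebra_simps)
    ultimately show ?thesis by linarith
  qed
  have tel: "(\<Sum>m<M. (Y N m)\<^sup>2) \<le> 4 * X" if "M \<le> N" for N M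
  proof -
    have mono: "(\<Sum>m<M. (Y N m)\<^sup>2) \<le> (\<Sum>m<N. (Y N m)\<^sup>2)"
      using that by (intro sum_mono2) auto
    have "(\<Sum>m<N. (Y N m)\<^sup>2 / 2 - 2 * (x m)\<^sup>2) \<le>
        (\<Sum>m<N. real (Suc m) * (Y N (Suc m))\<^sup>2 - m * (Y N m)\<^sup>2)"
      by (intro sum_mono step) auto
    also have "\<dots> = 0" by (subst sum_lessThan_telescope[of "\<lambda>m. real m * (Y N m)\<^sup>2"]) (simp add: Y_def)
    finally have "(\<Sum>m<N. (Y N m)\<^sup>2) \<le> 4 * (\<Sum>m<N. (x m)\<^sup>2)"
      by (simp add: sum_subtractf flip: sum_distrib_left sum_divide_distrib)
    moreover have "(\<Sum>m<N. (x m)\<^sup>2) \<le> X"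
      unfolding X_def by (intro sum_le_suminf x2) auto
    ultimately show ?thesis using mono by linarith
  qed
  have lim: "(\<lambda>N. Y N m) \<longlonglongrightarrow> (\<Sum>n. x (n + m) / Suc (n + m))" for m
  proof -
    have "summable (\<lambda>n. x (n + m) / Suc (n + m))"
      using sm by (subst summable_iff_shift)
    then have "(\<lambda>N. \<Sum>n<N. x (n + m) / Suc (n + m)) \<longlonglongrightarrow> (\<Sum>n. x (n + m) / Suc (n + m))"
      by (rule summable_LIMSEQ)
    moreover have "(\<Sum>n<N. x (n + m) / Suc (n + m)) = Y (N + m) m" for N
      unfolding Y_def using sum.shift_bounds_nat_ivl[of "\<lambda>n. x n / Suc n" 0 m N]
      by (simp add: atLeast0LessThan)
    ultimately have "(\<lambda>N. Y (N + m) m) \<longlonglongrightarrow> (\<Sum>n. x (n + m) / Suc (n + m))" by simp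
    then show ?thesis by (rule LIMSEQ_offset)
  qed
  show "summable (\<lambda>m. (\<Sum>n. x (n + m) / Suc (n + m))\<^sup>2)"
  proof (rule bounded_imp_summable)
    fix M
    have "(\<lambda>N. \<Sum>m<Suc M. (Y N m)\<^sup>2) \<longlonglongrightarrow> (\<Sum>m<Suc M. (\<Sum>n. x (n + m) / Suc (n + m))\<^sup>2)"
      by (intro tendsto_sum tendsto_power lim)
    then have "(\<Sum>m<Suc M. (\<Sum>n. x (n + m) / Suc (n + m))\<^sup>2) \<le> 4 * X"
      by (rule LIMSEQ_le_const2) (use tel in blast)
    then show "(\<Sum>m\<le>M. (\<Sum>n. x (n + m) / Suc (n + m))\<^sup>2) \<le> 4 * X"
      by (simp add: lessThan_Suc_atMost)
  qed simp
qed

section \<open>The Hardy space and square-summable Taylor coefficients\<close>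

lemma has_integral_cis:
  "((\<lambda>t. cis (of_int k * t)) has_integral (if k = 0 then 2 * of_real pi else 0)) {0..2 * pi}"
proof (cases "k = 0")
  case True
  then show ?thesis
    using has_integral_const_real[of "1 :: complex" 0 "2 * pi"] by (simp add: scaleR_conv_of_real)
next
  case False
  have "((\<lambda>t. cis (of_int k * t)) has_integral
      cis (of_int k * (2 * pi)) / (\<i> * of_int k) - cis (of_int k * 0) / (\<i> * of_int k)) {0..2 * pi}"
  proof (rule fundamental_theorem_of_calculus)
    fix t assume "t \<in> {0..2 * pi}"
    have "((\<lambda>x. exp (\<i> * of_int k * x) / (\<i> * of_int k)) has_field_derivative
        exp (\<i> * of_int k * of_real t)) (at (of_real t))"
      using False by (auto intro!: derivative_eq_intros)
    from has_vector_derivative_real_field[OF this]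
    show "((\<lambda>t. cis (of_int k * t) / (\<i> * of_int k)) has_vector_derivative
        cis (of_int k * t)) (at t within {0..2 * pi})"
      by (simp add: cis_conv_exp mult.assoc)
  qed simp
  moreover have "cis (of_int k * (2 * pi)) = 1"
    using cis_multiple_2pi[of "of_int k"] by (simp add: mult_ac)
  ultimately show ?thesis using False by simp
qed

lemma has_integral_trig_polynomial_square:
  fixes b :: "nat \<Rightarrow> complex"
  shows "((\<lambda>t. (cmod (\<Sum>n<N. b n * cis (n * t)))\<^sup>2) has_integral
    2 * pi * (\<Sum>n<N. (cmod (b n))\<^sup>2)) {0..2 * pi}"
proof -
  define P where "P t = (\<Sum>n<N. b n * cis (real n * t))" for t
  have "of_real ((cmod (P t))\<^sup>2) =
      (\<Sum>n<N. \<Sum>m<N. b n * cnj (b m) * cis (of_int (int n - int m) * t))" for t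
  proof -
    have "of_real ((cmod (P t))\<^sup>2) = P t * cnj (P t)"
      by (simp only: complex_norm_square)
    also have "\<dots> = (\<Sum>n<N. \<Sum>m<N. (b n * cis (real n * t)) * cnj (b m * cis (real m * t)))"
      unfolding P_def cnj_sum sum_product ..
    also have "\<dots> = (\<Sum>n<N. \<Sum>m<N. b n * cnj (b m) * cis (of_int (int n - int m) * t))"
    proof (intro sum.cong refl)
      fix n m
      have "cis (real n * t) * cnj (cis (real m * t)) = cis (of_int (int n - int m) * t)"
        by (simp add: cis_cnj cis_mult left_diff_distrib)
      then show "(b n * cis (real n * t)) * cnj (b m * cis (real m * t)) =
          b n * cnj (b m) * cis (of_int (int n - int m) * t)"
        by (metis (no_types, lifting) complex_cnj_mult mult.assoc mult.left_commute)
    qed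
    finally show ?thesis .
  qed
  moreover have "((\<lambda>t. \<Sum>n<N. \<Sum>m<N. b n * cnj (b m) * cis (of_int (int n - int m) * t)) has_integral
      (\<Sum>n<N. \<Sum>m<N. b n * cnj (b m) * (if int n - int m = 0 then 2 * of_real pi else 0))) {0..2 * pi}"
    by (intro has_integral_sum has_integral_mult_right has_integral_cis) auto
  moreover have "(\<Sum>n<N. \<Sum>m<N. b n * cnj (b m) * (if int n - int m = 0 then 2 * of_real pi else 0)) =
      complex_of_real (2 * pi * (\<Sum>n<N. (cmod (b n))\<^sup>2))"
  proof -
    have "(\<Sum>m<N. b n * cnj (b m) * (if int n - int m = 0 then 2 * of_real pi else 0)) =
        complex_of_real (2 * pi * (cmod (b n))\<^sup>2)" if "n < N" for n
    proof -
      have "(\<Sum>m<N. b n * cnj (b m) * (if int n - int m = 0 then 2 * of_real pi else 0)) =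
          (\<Sum>m<N. if m = n then b n * cnj (b m) * (2 * of_real pi) else 0)"
        by (intro sum.cong) auto
      also have "\<dots> = b n * cnj (b n) * (2 * of_real pi)"
        using that by simp
      also have "\<dots> = complex_of_real (2 * pi * (cmod (b n))\<^sup>2)"
        by (simp add: complex_norm_square[symmetric] mult_ac flip: of_real_power)
      finally show ?thesis .
    qed
    then show ?thesis by (simp add: sum_distrib_left)
  qed
  ultimately have "((\<lambda>t. complex_of_real ((cmod (P t))\<^sup>2)) has_integral
      complex_of_real (2 * pi * (\<Sum>n<N. (cmod (b n))\<^sup>2))) {0..2 * pi}"
    by simp
  from has_integral_Re[OF this] show ?thesis
    unfolding P_def Re_complex_of_real .
qed

text \<open>Parseval's identity on the circle of radius \<open>r\<close>. It holds for the partial sums by orthogonality and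
passes to the limit because the coefficients \<open>c n * r ^ n\<close> are absolutely summable, which provides
a dominating constant.\<close>

lemma circle_mean_power_series:
  fixes c :: "nat \<Rightarrow> complex"
  assumes g: "\<And>w. cmod w < 1 \<Longrightarrow> (\<lambda>n. c n * w ^ n) sums g w" and r: "0 < r" "r < 1"
  shows "(\<lambda>n. (cmod (c n))\<^sup>2 * r ^ (2 * n)) sums
    (1 / (2 * pi) * integral {0..2 * pi} (\<lambda>t. (cmod (g (of_real r * cis t)))\<^sup>2))"
proof -
  define b where "b n = c n * of_real r ^ n" for n
  have sb: "summable (\<lambda>n. cmod (b n))"
    unfolding b_def
  proof (rule powser_insidea)
    have "cmod (of_real ((1 + r) / 2)) < 1" using r unfolding norm_of_real by simp
    from sums_summable[OF g[OF this]] show "summable (\<lambda>n. c n * of_real ((1 + r) / 2) ^ n)" .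
    show "norm (complex_of_real r) < norm (complex_of_real ((1 + r) / 2))"
      using r unfolding norm_of_real by simp
  qed
  define P where "P N t = (\<Sum>n<N. b n * cis (real n * t))" for N t
  have P: "((\<lambda>t. (cmod (P N t))\<^sup>2) has_integral 2 * pi * (\<Sum>n<N. (cmod (b n))\<^sup>2)) {0..2 * pi}" for N
    unfolding P_def by (rule has_integral_trig_polynomial_square)
  have lim: "(\<lambda>N. P N t) \<longlonglongrightarrow> g (of_real r * cis t)" for t
  proof -
    have "(\<lambda>n. c n * (of_real r * cis t) ^ n) sums g (of_real r * cis t)"
      using r by (intro g) (simp add: norm_mult)
    moreover have "c n * (of_real r * cis t) ^ n = b n * cis (real n * t)" for n
      by (simp only: power_mult_distrib Complex.DeMoivre b_def mult.assoc)
    ultimately show ?thesis unfolding sums_def P_def by (simp only:)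
  qed
  have bound: "cmod (P N t) \<le> (\<Sum>n. cmod (b n))" for N t
  proof -
    have "cmod (P N t) \<le> (\<Sum>n<N. cmod (b n * cis (real n * t)))"
      unfolding P_def by (rule norm_sum)
    also have "\<dots> = (\<Sum>n<N. cmod (b n))" by (simp add: norm_mult)
    also have "\<dots> \<le> (\<Sum>n. cmod (b n))" by (intro sum_le_suminf sb) auto
    finally show ?thesis .
  qed
  have "(\<lambda>N. integral {0..2 * pi} (\<lambda>t. (cmod (P N t))\<^sup>2)) \<longlonglongrightarrow>
      integral {0..2 * pi} (\<lambda>t. (cmod (g (of_real r * cis t)))\<^sup>2)"
  proof (rule dominated_convergence(2))
    show "(\<lambda>t. (cmod (P N t))\<^sup>2) integrable_on {0..2 * pi}" for N
      using P by (rule has_integral_integrable)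
    show "(\<lambda>t. (\<Sum>n. cmod (b n))\<^sup>2) integrable_on {0..2 * pi}"
      by (rule integrable_const_ivl)
    show "norm ((cmod (P N t))\<^sup>2) \<le> (\<Sum>n. cmod (b n))\<^sup>2" for N t
      using bound[of N t] by (simp add: power_mono)
    show "(\<lambda>N. (cmod (P N t))\<^sup>2) \<longlonglongrightarrow> (cmod (g (of_real r * cis t)))\<^sup>2" for t
      by (intro tendsto_power tendsto_norm lim)
  qed
  then have "(\<lambda>N. 1 / (2 * pi) * (2 * pi * (\<Sum>n<N. (cmod (b n))\<^sup>2))) \<longlonglongrightarrow>
      1 / (2 * pi) * integral {0..2 * pi} (\<lambda>t. (cmod (g (of_real r * cis t)))\<^sup>2)"
    unfolding integral_unique[OF P] by (rule tendsto_mult_left)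
  moreover have "(cmod (b n))\<^sup>2 = (cmod (c n))\<^sup>2 * r ^ (2 * n)" for n
    using r by (simp add: b_def norm_mult norm_power power_mult_distrib power_mult[symmetric] mult.commute)
  ultimately show ?thesis by (simp add: sums_def)
qed

lemma ell2_power_series_in_hardy2:
  assumes c: "ell2 c" and g: "\<And>w. cmod w < 1 \<Longrightarrow> (\<lambda>n. c n * w ^ n) sums g w"
  shows "g \<in> hardy2"
proof -
  have "g holomorphic_on ball 0 1"
    by (rule power_series_holomorphic[of 0 1 c]) (use g in auto)
  moreover
  have "1 / (2 * pi) * integral {0..2 * pi} (\<lambda>t. (cmod (g (of_real r * cis t)))\<^sup>2) \<le>
      (\<Sum>n. (cmod (c n))\<^sup>2)" if "r \<in> {0<..<1}" for r
  proof (rule sums_le[OF _ circle_mean_power_series[OF g]])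
    show "(cmod (c n))\<^sup>2 * r ^ (2 * n) \<le> (cmod (c n))\<^sup>2" for n
      using that by (intro mult_left_le power_le_one) auto
  qed (use that c in \<open>auto intro: summable_sums\<close>)
  then have "bdd_above ((\<lambda>r. 1 / (2 * pi) * integral {0..2 * pi} (\<lambda>t. (cmod (g (of_real r * cis t)))\<^sup>2)) ` {0<..<1})"
    by (rule bdd_aboveI2)
  ultimately show ?thesis by (simp only: hardy2_def mem_Collect_eq simp_thms)
qed

lemma hardy2_taylor_ell2:
  assumes "g \<in> hardy2"
  obtains c where "ell2 c" "\<And>w. cmod w < 1 \<Longrightarrow> (\<lambda>n. c n * w ^ n) sums g w"
proof
  define c where "c n = (deriv ^^ n) g 0 / fact n" for n
  show g: "(\<lambda>n. c n * w ^ n) sums g w" if "cmod w < 1" for w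
    using holomorphic_power_series[of g 0 1 w] assms that by (simp add: hardy2_def c_def)
  obtain B where B: "\<And>r. r \<in> {0<..<1} \<Longrightarrow>
      1 / (2 * pi) * integral {0..2 * pi} (\<lambda>t. (cmod (g (of_real r * cis t)))\<^sup>2) \<le> B"
    using assms unfolding hardy2_def bdd_above_def by blast
  show "ell2 c"
  proof (rule bounded_imp_summable)
    fix N
    have "((\<lambda>r. \<Sum>n\<le>N. (cmod (c n))\<^sup>2 * r ^ (2 * n)) \<longlongrightarrow> (\<Sum>n\<le>N. (cmod (c n))\<^sup>2 * 1 ^ (2 * n))) (at_left 1)"
      by (intro tendsto_intros)
    moreover have "\<forall>\<^sub>F r in at_left 1. (\<Sum>n\<le>N. (cmod (c n))\<^sup>2 * r ^ (2 * n)) \<le> B"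
      using eventually_at_left_real[OF zero_less_one]
    proof eventually_elim
      case (elim r)
      then have "0 < r" "r < 1" by auto
      note s = circle_mean_power_series[OF g this]
      have "(\<Sum>n\<le>N. (cmod (c n))\<^sup>2 * r ^ (2 * n)) \<le> (\<Sum>n. (cmod (c n))\<^sup>2 * r ^ (2 * n))"
        using sums_summable[OF s] \<open>0 < r\<close> by (intro sum_le_suminf) auto
      also have "\<dots> \<le> B" using B[OF elim] sums_unique[OF s] by simp
      finally show ?case .
    qed
    ultimately show "(\<Sum>n\<le>N. (cmod (c n))\<^sup>2) \<le> B"
      using tendsto_upperbound[of _ "\<Sum>n\<le>N. (cmod (c n))\<^sup>2 * 1 ^ (2 * n)" "at_left (1::real)" B] by simp
  qed simp
qed

section \<open>Interpolation at the nodes\<close>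

locale circle_nodes =
  fixes J :: nat and z :: "nat \<Rightarrow> complex"
  assumes norm_node: "j \<in> {1..J} \<Longrightarrow> cmod (z j) = 1"
    and inj_node: "inj_on z {1..J}"
begin

text \<open>At \<open>w = z j\<close> this is the constant \<open>D j\<close> of the introduction.\<close>

definition cofactor :: "nat \<Rightarrow> complex \<Rightarrow> complex" where
  "cofactor j w = (\<Prod>i\<in>{1..J} - {j}. 1 - cnj (z i) * w)"

lemma cnj_node_mult: "j \<in> {1..J} \<Longrightarrow> cnj (z j) * z j = 1"
  using complex_norm_square[of "z j"] norm_node[of j] by (simp add: mult.commute)

lemma node_factor_eq_0_iff:
  assumes "i \<in> {1..J}" "j \<in> {1..J}"
  shows "1 - cnj (z i) * z j = 0 \<longleftrightarrow> i = j"
proof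
  assume "1 - cnj (z i) * z j = 0"
  then have "cnj (z i) * z j = cnj (z i) * z i" using cnj_node_mult[OF assms(1)] by simp
  moreover have "cnj (z i) \<noteq> 0" using norm_node[OF assms(1)] by auto
  ultimately have "z i = z j" by simp
  then show "i = j" using inj_node assms by (auto dest: inj_onD)
qed (use cnj_node_mult assms in auto)

lemma phi_eq_cofactor: "j \<in> {1..J} \<Longrightarrow> phi J z w = (1 - cnj (z j) * w) * cofactor j w"
  unfolding phi_def cofactor_def by (rule prod.remove) auto

lemma cofactor_node_nonzero: "j \<in> {1..J} \<Longrightarrow> cofactor j (z j) \<noteq> 0"
  unfolding cofactor_def using node_factor_eq_0_iff by auto

lemma cofactor_other_node: "i \<in> {1..J} \<Longrightarrow> j \<in> {1..J} \<Longrightarrow> i \<noteq> j \<Longrightarrow> cofactor j (z i) = 0"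
  unfolding cofactor_def using node_factor_eq_0_iff[of i i] by auto

text \<open>Both sides are polynomials in \<open>w\<close> of degree at most \<open>J\<close> that agree at the \<open>J + 1\<close> points
\<open>0, z 1, \<dots>, z J\<close>: at \<open>z k\<close> only the summand with \<open>j = k\<close> survives, and at \<open>0\<close> both sides are \<open>1\<close>.\<close>

lemma phi_interpolation:
  "phi J z (a * w) = phi J z w +
    (\<Sum>j=1..J. phi J z (a * z j) / cofactor j (z j) * (cnj (z j) * w) * cofactor j w)"
proof -
  define P where "P = (\<Prod>i\<in>{1..J}. [:1, - (cnj (z i) * a):])"
  define R where "R j = smult (phi J z (a * z j) / cofactor j (z j))
      ([:0, cnj (z j):] * (\<Prod>i\<in>{1..J} - {j}. [:1, - cnj (z i):]))" for j
  define Q where "Q = (\<Prod>i\<in>{1..J}. [:1, - cnj (z i):]) + (\<Sum>j\<in>{1..J}. R j)"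
  have P: "poly P x = phi J z (a * x)" for x
    by (simp add: P_def poly_prod phi_def algebra_simps)
  have R: "poly (R j) x = phi J z (a * z j) / cofactor j (z j) * (cnj (z j) * x) * cofactor j x" for j x
    by (simp add: R_def poly_prod cofactor_def algebra_simps)
  have Q: "poly Q x = phi J z x + (\<Sum>j\<in>{1..J}. poly (R j) x)" for x
    by (simp add: Q_def poly_prod phi_def poly_sum algebra_simps)
  have deg: "degree (\<Prod>i\<in>I. [:1, h i:]) \<le> card I" if "finite I" for I and h :: "nat \<Rightarrow> complex"
  proof -
    have "degree (\<Prod>i\<in>I. [:1, h i:]) \<le> (\<Sum>i\<in>I. degree [:1, h i:])"
      using degree_prod_sum_le[OF that, of "\<lambda>i. [:1, h i:]"] by (simp add: o_def)
    also have "\<dots> \<le> (\<Sum>i\<in>I. 1)" by (intro sum_mono) simp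
    finally show ?thesis by simp
  qed
  have "degree P \<le> J" unfolding P_def using deg[of "{1..J}"] by simp
  have degR: "degree (R j) \<le> J" if "j \<in> {1..J}" for j
  proof -
    have "degree (R j) \<le> degree ([:0, cnj (z j):] * (\<Prod>i\<in>{1..J} - {j}. [:1, - cnj (z i):]))"
      unfolding R_def by (rule degree_smult_le)
    also have "\<dots> \<le> degree [:0, cnj (z j):] + degree (\<Prod>i\<in>{1..J} - {j}. [:1, - cnj (z i):])"
      by (rule degree_mult_le)
    also have "\<dots> \<le> 1 + card ({1..J} - {j})" using deg by (intro add_mono) auto
    also have "\<dots> = J" using that by simp
    finally show ?thesis .
  qed
  have "degree Q \<le> J" unfolding Q_def
    using deg[of "{1..J}"] by (intro degree_add_le degree_sum_le) (auto intro: degR)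
  have card: "card (insert 0 (z ` {1..J})) = Suc J"
  proof -
    have "0 \<notin> z ` {1..J}" using norm_node by force
    then show ?thesis using card_image[OF inj_node] by simp
  qed
  have "P = Q"
  proof (rule poly_eqI_degree)
    fix x assume "x \<in> insert 0 (z ` {1..J})"
    then consider "x = 0" | k where "k \<in> {1..J}" "x = z k" by auto
    then show "poly P x = poly Q x"
    proof cases
      case 1
      then show ?thesis by (simp add: P Q R phi_def)
    next
      case 2
      have "(\<Sum>j\<in>{1..J}. poly (R j) x) = (\<Sum>j\<in>{1..J}. if j = k then poly (R j) x else 0)"
        using 2 cofactor_other_node by (intro sum.cong) (auto simp: R)
      also have "\<dots> = poly (R k) x" using 2 by simp
      also have "\<dots> = phi J z (a * x)"
        using 2 cofactor_node_nonzero cnj_node_mult by (simp add: R)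
      finally show ?thesis
        using 2 phi_eq_cofactor[of k x] cnj_node_mult[of k] by (simp add: P Q)
    qed
  qed (use card \<open>degree P \<le> J\<close> \<open>degree Q \<le> J\<close> in auto)
  then have "poly P w = poly Q w" by simp
  then show ?thesis by (simp only: P Q R)
qed

end

section \<open>Dividing a basis series by the polynomial\<close>

locale kernel_basis = circle_nodes +
  fixes a :: "nat \<Rightarrow> complex" and p :: real
  assumes a_limit: "(\<lambda>n. of_nat n * (1 - a n)) \<longlonglongrightarrow> complex_of_real p"
begin

abbreviation f :: "nat \<Rightarrow> complex \<Rightarrow> complex" where
  "f \<equiv> basis_fun J z a"

definition partial_value :: "(nat \<Rightarrow> complex) \<Rightarrow> nat \<Rightarrow> nat \<Rightarrow> complex" where
  "partial_value \<alpha> j m = (\<Sum>n<m. \<alpha> n * f n (z j))"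

text \<open>The Taylor coefficients of the basis series divided by \<open>phi J z\<close>, see
\<open>basis_series_eq_phi_times_quotient\<close>.\<close>

definition quotient_coeff :: "(nat \<Rightarrow> complex) \<Rightarrow> nat \<Rightarrow> complex" where
  "quotient_coeff \<alpha> m = \<alpha> m + (\<Sum>j=1..J. cnj (z j) ^ m / cofactor j (z j) * partial_value \<alpha> j m)"

text \<open>The factor \<open>1 - cnj (z j) * (a n * z j)\<close> of \<open>phi J z (a n * z j)\<close> equals \<open>1 - a n\<close>, and the other
factors converge to those of \<open>cofactor j (z j)\<close> because \<open>a n\<close> tends to \<open>1\<close>.\<close>

lemma basis_fun_node_limit:
  assumes j: "j \<in> {1..J}"
  shows "(\<lambda>n. of_nat n * (phi J z (a n * z j) / cofactor j (z j))) \<longlonglongrightarrow> complex_of_real p"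
proof -
  have "(\<lambda>n. inverse (of_nat n) * (of_nat n * (1 - a n))) \<longlonglongrightarrow> 0 * complex_of_real p"
    by (intro tendsto_mult a_limit lim_inverse_n)
  moreover have "\<forall>\<^sub>F n in sequentially. inverse (of_nat n) * (of_nat n * (1 - a n)) = 1 - a n"
    using eventually_gt_at_top[of 0] by eventually_elim simp
  ultimately have "(\<lambda>n. 1 - a n) \<longlonglongrightarrow> 0"
    by (simp add: tendsto_cong)
  from tendsto_diff[OF tendsto_const[of 1] this] have a1: "a \<longlonglongrightarrow> 1" by simp
  have "(\<lambda>n. of_nat n * (1 - a n) * (cofactor j (a n * z j) / cofactor j (z j))) \<longlonglongrightarrow>
      of_real p * (cofactor j (1 * z j) / cofactor j (z j))"
    unfolding cofactor_def
    by (intro tendsto_mult a_limit tendsto_divide tendsto_prod tendsto_diff tendsto_const a1)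
       (use cofactor_node_nonzero[OF j] in \<open>simp add: cofactor_def\<close>)
  moreover have "phi J z (a n * z j) = (1 - a n) * cofactor j (a n * z j)" for n
    using phi_eq_cofactor[OF j, of "a n * z j"] cnj_node_mult[OF j]
    by (simp add: mult.left_commute)
  ultimately show ?thesis using cofactor_node_nonzero[OF j] by (simp add: mult.assoc)
qed

lemma basis_fun_node_bound:
  assumes j: "j \<in> {1..J}"
  obtains C where "\<And>n. cmod (f n (z j)) \<le> C / Suc n"
proof -
  have "Bseq (\<lambda>n. of_nat n * (phi J z (a n * z j) / cofactor j (z j)))"
    using basis_fun_node_limit[OF j] convergent_imp_Bseq convergent_def by blast
  then obtain K where K: "K > 0" "\<And>n. cmod (of_nat n * (phi J z (a n * z j) / cofactor j (z j))) \<le> K"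
    by (auto elim: BseqE)
  define D where "D = cmod (cofactor j (z j))"
  have D: "D > 0" using cofactor_node_nonzero[OF j] by (simp add: D_def)
  have fn: "cmod (f n (z j)) = cmod (phi J z (a n * z j))" for n
    using norm_node[OF j] by (simp add: basis_fun_def norm_mult norm_power)
  have 1: "real n * cmod (f n (z j)) \<le> K * D" for n
    using K(2)[of n] D by (simp add: fn norm_mult norm_divide field_simps flip: D_def)
  show thesis
  proof
    show "cmod (f n (z j)) \<le> (cmod (f 0 (z j)) + 2 * K * D) / Suc n" for n
    proof (cases "n = 0")
      case True
      then show ?thesis using K D by simp
    next
      case False
      have "real (Suc n) * cmod (f n (z j)) \<le> (2 * n) * cmod (f n (z j))"
        using False by (intro mult_right_mono) auto
      also have "\<dots> \<le> 2 * K * D" using 1[of n] by simp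
      also have "\<dots> \<le> cmod (f 0 (z j)) + 2 * K * D" by simp
      finally show ?thesis by (simp add: field_simps)
    qed
  qed
qed

lemma basis_fun_node_ell2:
  assumes j: "j \<in> {1..J}"
  shows "ell2 (\<lambda>n. f n (z j))"
proof -
  obtain C where C: "\<And>n. cmod (f n (z j)) \<le> C / Suc n" using basis_fun_node_bound[OF j] by blast
  show ?thesis
  proof (rule ell2_le)
    show "\<forall>\<^sub>F n in sequentially. cmod (f n (z j)) \<le> C * inverse (real (Suc n))"
      using C by (simp add: divide_inverse)
    have "summable (\<lambda>n. C\<^sup>2 * inverse (real (Suc n) ^ 2))"
      using inverse_power_summable[of 2, where 'a = real] summable_Suc_iff[of "\<lambda>n. inverse (real n ^ 2)"]
      by (intro summable_mult) simp
    then show "summable (\<lambda>n. (C * inverse (real (Suc n)))\<^sup>2)"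
      by (simp add: power_mult_distrib power_inverse)
  qed
qed

text \<open>By \<open>phi_interpolation\<close>, each \<open>f m w\<close> is \<open>w ^ m * phi J z w\<close> plus a combination of
the terms \<open>phi J z (a m * z j) * x j * w ^ m\<close>, where \<open>x j = cnj (z j) * w\<close>. Since \<open>cnj (z j)\<close> is the
inverse of \<open>z j\<close>, such a term times \<open>\<alpha> m\<close> is the increment of \<open>partial_value \<alpha> j\<close> times
\<open>x j ^ Suc m\<close>, and summation by parts makes the factor \<open>1 - x j\<close> appear, which completes
\<open>cofactor j w\<close> to \<open>phi J z w\<close>.\<close>

lemma basis_series_eq_phi_times_quotient:
  assumes \<alpha>: "ell2 \<alpha>" and w: "cmod w < 1"
  obtains \<gamma> where "(\<lambda>m. quotient_coeff \<alpha> m * w ^ m) sums \<gamma>"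
    "(\<lambda>n. \<alpha> n * f n w) sums (phi J z w * \<gamma>)"
proof -
  define x where "x j = cnj (z j) * w" for j
  define \<sigma> where "\<sigma> j = (\<Sum>m. partial_value \<alpha> j m * x j ^ m)" for j
  define A where "A = (\<Sum>m. \<alpha> m * w ^ m)"
  have A: "(\<lambda>m. \<alpha> m * w ^ m) sums A"
    unfolding A_def by (intro summable_sums summable_power_series_Bseq ell2_imp_Bseq \<alpha> w)
  have \<sigma>: "(\<lambda>m. partial_value \<alpha> j m * x j ^ m) sums \<sigma> j" if j: "j \<in> {1..J}" for j
  proof -
    have "summable (\<lambda>n. \<alpha> n * f n (z j))"
      by (intro ell2_summable_mult \<alpha> basis_fun_node_ell2 j)
    then have "Bseq (partial_value \<alpha> j)"
      unfolding partial_value_def summable_iff_convergent by (rule convergent_imp_Bseq)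
    moreover have "cmod (x j) < 1" using w norm_node[OF j] by (simp add: x_def norm_mult)
    ultimately show ?thesis
      unfolding \<sigma>_def by (intro summable_sums summable_power_series_Bseq)
  qed
  have d: "(\<lambda>m. \<alpha> m * w ^ m * (phi J z (a m * z j) * x j)) sums ((1 - x j) * \<sigma> j)"
    if j: "j \<in> {1..J}" for j
  proof -
    have "(\<lambda>m. (partial_value \<alpha> j (Suc m) - partial_value \<alpha> j m) * x j ^ Suc m) sums ((1 - x j) * \<sigma> j)"
      by (rule sums_difference_power_series[OF _ \<sigma>[OF j]]) (simp add: partial_value_def)
    moreover have eq: "(partial_value \<alpha> j (Suc m) - partial_value \<alpha> j m) * x j ^ Suc m =
        \<alpha> m * w ^ m * (phi J z (a m * z j) * x j)" for m
    proof -
      have "z j ^ m * cnj (z j) ^ m = 1"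
        using cnj_node_mult[OF j] by (simp add: mult.commute flip: power_mult_distrib)
      then have "z j ^ m * x j ^ m = w ^ m"
        by (simp add: x_def power_mult_distrib flip: mult.assoc)
      then show ?thesis by (simp add: partial_value_def basis_fun_def mult_ac)
    qed
    ultimately show ?thesis unfolding eq by simp
  qed
  define \<gamma> where "\<gamma> = A + (\<Sum>j=1..J. \<sigma> j / cofactor j (z j))"
  show thesis
  proof
    have "(\<lambda>m. \<alpha> m * w ^ m + (\<Sum>j=1..J. (partial_value \<alpha> j m * x j ^ m) / cofactor j (z j))) sums \<gamma>"
      unfolding \<gamma>_def by (intro sums_add A sums_sum sums_divide \<sigma>)
    then show "(\<lambda>m. quotient_coeff \<alpha> m * w ^ m) sums \<gamma>"
      by (simp add: quotient_coeff_def x_def power_mult_distrib sum_distrib_left distrib_left mult_ac)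
    have "(\<lambda>m. \<alpha> m * w ^ m * phi J z w +
        (\<Sum>j=1..J. \<alpha> m * w ^ m * (phi J z (a m * z j) * x j) * (cofactor j w / cofactor j (z j)))) sums
        (A * phi J z w + (\<Sum>j=1..J. (1 - x j) * \<sigma> j * (cofactor j w / cofactor j (z j))))"
      by (intro sums_add sums_sum sums_mult2 A d)
    moreover have "\<alpha> m * w ^ m * phi J z w +
        (\<Sum>j=1..J. \<alpha> m * w ^ m * (phi J z (a m * z j) * x j) * (cofactor j w / cofactor j (z j))) =
        \<alpha> m * f m w" for m
      unfolding basis_fun_def phi_interpolation[of "a m" w]
      by (simp add: x_def distrib_left sum_distrib_left mult_ac)
    moreover have "A * phi J z w + (\<Sum>j=1..J. (1 - x j) * \<sigma> j * (cofactor j w / cofactor j (z j))) =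
        phi J z w * \<gamma>"
    proof -
      have "(\<Sum>j=1..J. (1 - x j) * \<sigma> j * (cofactor j w / cofactor j (z j))) =
          (\<Sum>j=1..J. phi J z w * (\<sigma> j / cofactor j (z j)))"
        by (intro sum.cong) (simp_all add: phi_eq_cofactor x_def)
      then show ?thesis by (simp add: \<gamma>_def distrib_left sum_distrib_left)
    qed
    ultimately show "(\<lambda>n. \<alpha> n * f n w) sums (phi J z w * \<gamma>)" by simp
  qed
qed

text \<open>When the whole series vanishes at \<open>z j\<close>, its partial sums are minus its tails, whose terms are
\<open>O(\<bar>\<alpha> n\<bar> / n)\<close>.\<close>

lemma quotient_coeff_ell2:
  assumes \<alpha>: "ell2 \<alpha>" and van: "\<And>j. j \<in> {1..J} \<Longrightarrow> (\<Sum>n. \<alpha> n * f n (z j)) = 0"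
  shows "ell2 (quotient_coeff \<alpha>)"
proof -
  have "ell2 (\<lambda>m. cnj (z j) ^ m / cofactor j (z j) * partial_value \<alpha> j m)" if j: "j \<in> {1..J}" for j
  proof -
    obtain C where C: "\<And>n. cmod (f n (z j)) \<le> C / Suc n"
      using basis_fun_node_bound[OF j] by blast
    define T where "T m = (\<Sum>n. cmod (\<alpha> (n + m)) / Suc (n + m))" for m
    note tail = hardy_tail_summable[of "\<lambda>n. cmod (\<alpha> n)", OF norm_ge_zero \<alpha>]
    have s: "summable (\<lambda>n. \<alpha> n * f n (z j))"
      by (intro ell2_summable_mult \<alpha> basis_fun_node_ell2 j)
    have "cmod (partial_value \<alpha> j m) \<le> C * T m" for m
    proof -
      have sm: "summable (\<lambda>n. C * (cmod (\<alpha> (n + m)) / Suc (n + m)))"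
        using tail(1) by (intro summable_mult) (subst summable_iff_shift)
      have le: "cmod (\<alpha> n * f n (z j)) \<le> C * (cmod (\<alpha> n) / Suc n)" for n
        using mult_left_mono[OF C[of n], of "cmod (\<alpha> n)"] by (simp add: norm_mult mult.commute)
      have "partial_value \<alpha> j m = - (\<Sum>n. \<alpha> (n + m) * f (n + m) (z j))"
        using suminf_split_initial_segment[OF s, of m] van[OF j]
        by (simp add: partial_value_def add_eq_0_iff)
      also have "cmod \<dots> \<le> (\<Sum>n. C * (cmod (\<alpha> (n + m)) / Suc (n + m)))"
        unfolding norm_minus_cancel by (rule norm_suminf_le[OF le sm])
      also have "\<dots> = C * T m"
        unfolding T_def using tail(1) by (intro suminf_mult) (subst summable_iff_shift)
      finally show ?thesis .
    qed
    then have "cmod (cnj (z j) ^ m / cofactor j (z j) * partial_value \<alpha> j m) \<le>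
        C / cmod (cofactor j (z j)) * T m" for m
      using norm_node[OF j] cofactor_node_nonzero[OF j]
      by (simp add: norm_mult norm_divide norm_power divide_right_mono)
    moreover have "summable (\<lambda>m. (C / cmod (cofactor j (z j)) * T m)\<^sup>2)"
      unfolding power_mult_distrib T_def by (intro summable_mult tail(2))
    ultimately show ?thesis by (intro ell2_le[of _ "\<lambda>m. C / cmod (cofactor j (z j)) * T m"]) auto
  qed
  then show ?thesis unfolding quotient_coeff_def by (intro ell2_add ell2_sum \<alpha>)
qed

end

section \<open>A linear recursion with oscillating coefficients\<close>

text \<open>With \<open>\<omega> i j = z j * cnj (z i)\<close>, the recursion reads, up to lower order terms,
\<open>s j (m + 1) = s j m - p / m * (\<Sum>i\<in>I. \<omega> i j ^ m * s i m) + O(\<bar>g m\<bar> / m)\<close>.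
For \<open>i \<noteq> j\<close> the sequence \<open>\<omega> i j ^ m\<close> is the difference of the bounded
sequence \<open>\<omega> i j ^ m / (\<omega> i j - 1)\<close>, so it can be absorbed: the modified variables
\<open>V j m = s j m + p / m * (\<Sum>i\<in>I - {j}. \<omega> i j ^ m / (\<omega> i j - 1) * s i m)\<close> satisfy a recursion in which
only the damping \<open>1 - p / m\<close> remains, with an error of size \<open>o(1 / m)\<close> times the \<open>s i m\<close> plus
\<open>O(\<bar>g m\<bar> / m)\<close>. The sum \<open>W m\<close> of their moduli is then covered by \<open>weighted_decay_summable\<close> and dominates the \<open>s j m\<close>.\<close>

lemma oscillating_system_ell2:
  fixes z :: "'i \<Rightarrow> complex" and s \<rho> :: "'i \<Rightarrow> nat \<Rightarrow> complex" and p :: real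
  assumes fin: "finite I"
    and unit: "\<And>j. j \<in> I \<Longrightarrow> cmod (z j) = 1" and inj: "inj_on z I"
    and p: "p > 1 / 2"
    and \<rho>: "\<And>j. j \<in> I \<Longrightarrow> (\<lambda>m. of_nat m * \<rho> j m) \<longlonglongrightarrow> complex_of_real p"
    and rec: "\<And>j m. j \<in> I \<Longrightarrow>
      s j (Suc m) = s j m + z j ^ m * \<rho> j m * (g m - (\<Sum>i\<in>I. cnj (z i) ^ m * s i m))"
    and g: "ell2 g"
    and "j \<in> I"
  shows "ell2 (s j)"
proof -
  define y t where "y m = cmod (g m)" and "t m = (\<Sum>i\<in>I. cmod (s i m))" for m
  define h where "h m = g m - (\<Sum>i\<in>I. cnj (z i) ^ m * s i m)" for m
  define e where "e m = (\<Sum>j\<in>I. cmod (of_nat m * \<rho> j m - of_real p))" for m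
  define \<omega> where "\<omega> i j = z j * cnj (z i)" for i j
  define b where "b i j = 1 / (\<omega> i j - 1)" for i j
  define B where "B = (\<Sum>j\<in>I. \<Sum>i\<in>I. cmod (b i j))"
  define V where "V j m = s j m + of_real (p / m) * (\<Sum>i\<in>I - {j}. b i j * \<omega> i j ^ m * s i m)" for j m
  define W where "W m = (\<Sum>j\<in>I. cmod (V j m))" for m
  define N where "N = real (card I)"
  have p0: "p > 0" using p by simp
  have y0: "y m \<ge> 0" and t0: "t m \<ge> 0" and e0: "e m \<ge> 0" and W0: "W m \<ge> 0" for m
    by (auto simp: y_def t_def e_def W_def intro: sum_nonneg)
  have B0: "B \<ge> 0" unfolding B_def by (intro sum_nonneg) auto
  have N0: "N \<ge> 0" by (simp add: N_def)
  have norm_\<omega>: "cmod (\<omega> i j) = 1" if "i \<in> I" "j \<in> I" for i j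
    using that unit by (simp add: \<omega>_def norm_mult)
  have \<omega>_neq: "\<omega> i j \<noteq> 1" if "i \<in> I" "j \<in> I" "i \<noteq> j" for i j
  proof
    assume "\<omega> i j = 1"
    moreover have "cnj (z i) * z i = 1"
      using complex_norm_square[of "z i"] unit[OF that(1)] by (simp add: mult.commute)
    ultimately have "z j = z i"
      unfolding \<omega>_def by (metis mult.assoc mult.right_neutral mult.left_neutral)
    then show False using inj that by (auto dest: inj_onD)
  qed
  have s_le: "cmod (s i m) \<le> t m" if "i \<in> I" for i m
    unfolding t_def using that fin by (intro member_le_sum) auto
  have e_le: "cmod (of_nat m * \<rho> j m - of_real p) \<le> e m" if "j \<in> I" for j m
    unfolding e_def using that fin by (intro member_le_sum[where f = "\<lambda>j. cmod (of_nat m * \<rho> j m - of_real p)"]) auto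
  have b_le: "(\<Sum>i\<in>I - {j}. cmod (b i j)) \<le> B" if "j \<in> I" for j
  proof -
    have "(\<Sum>i\<in>I - {j}. cmod (b i j)) \<le> (\<Sum>i\<in>I. cmod (b i j))"
      using fin by (intro sum_mono2) auto
    also have "\<dots> \<le> B" unfolding B_def
      using that fin by (intro member_le_sum[where f = "\<lambda>j. \<Sum>i\<in>I. cmod (b i j)"] sum_nonneg) auto
    finally show ?thesis .
  qed
  have bsum_le: "cmod (\<Sum>i\<in>I - {j}. b i j * \<omega> i j ^ k * u i) \<le> B * K"
    if "j \<in> I" "\<And>i. i \<in> I \<Longrightarrow> cmod (u i) \<le> K" "K \<ge> 0" for j k u K
  proof -
    have "cmod (\<Sum>i\<in>I - {j}. b i j * \<omega> i j ^ k * u i) \<le> (\<Sum>i\<in>I - {j}. cmod (b i j) * K)"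
    proof (rule sum_norm_le)
      fix i assume "i \<in> I - {j}"
      then show "cmod (b i j * \<omega> i j ^ k * u i) \<le> cmod (b i j) * K"
        using that norm_\<omega> by (simp add: norm_mult norm_power mult_left_mono)
    qed
    also have "\<dots> = (\<Sum>i\<in>I - {j}. cmod (b i j)) * K" by (simp add: sum_distrib_right)
    also have "\<dots> \<le> B * K" using that b_le by (intro mult_right_mono) auto
    finally show ?thesis .
  qed
  have h_le: "cmod (h m) \<le> y m + t m" for m
  proof -
    have "cmod (\<Sum>i\<in>I. cnj (z i) ^ m * s i m) \<le> t m"
      unfolding t_def by (rule sum_norm_le) (simp add: norm_mult norm_power unit)
    then show ?thesis unfolding h_def y_def by (rule order_trans[OF norm_triangle_ineq4 add_left_mono])
  qed
  have e_lim: "e \<longlonglongrightarrow> 0"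
  proof -
    have "(\<lambda>m. cmod (of_nat m * \<rho> j m - of_real p)) \<longlonglongrightarrow> 0" if "j \<in> I" for j
      using \<rho>[OF that] by (simp add: tendsto_norm_zero LIM_zero)
    from tendsto_sum[of I "\<lambda>j m. cmod (of_nat m * \<rho> j m - of_real p)" "\<lambda>_. 0", OF this]
    show ?thesis by (simp add: e_def[abs_def])
  qed
  define \<kappa> where "\<kappa> m = e m + p\<^sup>2 * B / m + p * B * (p + 2) / m" for m
  define L where "L = 1 + p + p * B * (p + 1)"
  have V_close: "cmod (V j m - s j m) \<le> (p / m) * (B * t m)" if "j \<in> I" for j m
    using mult_left_mono[OF bsum_le[where k = m and u = "\<lambda>i. s i m" and K = "t m", OF that s_le t0], of "p / m"] p0
    by (simp add: V_def norm_mult norm_divide)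
  have step: "cmod (V j (Suc m) - of_real (1 - p / m) * V j m) \<le> (1 / m) * (\<kappa> m * t m + L * y m)"
    if j: "j \<in> I" and m: "m \<ge> 1" and e1: "e m \<le> 1" for j m
  proof -
    have m0: "real m > 0" and mc: "of_nat m \<noteq> (0 :: complex)" using m by auto
    have \<Delta>: "cmod (s i (Suc m) - s i m) \<le> (p + 1) / m * (y m + t m)" if i: "i \<in> I" for i
    proof -
      have "of_nat m * (s i (Suc m) - s i m) = z i ^ m * (of_nat m * \<rho> i m) * h m"
        using rec[OF i, of m] by (simp add: h_def mult_ac)
      then have "real m * cmod (s i (Suc m) - s i m) = cmod (of_nat m * \<rho> i m) * cmod (h m)"
        using unit[OF i] by (metis (no_types, lifting) mult.left_neutral norm_mult norm_of_nat norm_power power_one)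
      also have "\<dots> \<le> (p + 1) * (y m + t m)"
      proof (intro mult_mono h_le)
        have "cmod (of_nat m * \<rho> i m) \<le> cmod (of_nat m * \<rho> i m - of_real p) + cmod (of_real p)"
          using norm_triangle_ineq[of "of_nat m * \<rho> i m - of_real p" "of_real p"] by simp
        then show "cmod (of_nat m * \<rho> i m) \<le> p + 1" using e_le[OF i, of m] e1 p0 by simp
      qed (use p0 in auto)
      finally show ?thesis using m0 by (simp add: field_simps)
    qed
    \<comment> \<open>What is left after the damping term: \<open>X\<close> collects \<open>g\<close> and the deviation of \<open>m * \<rho> j m\<close> from \<open>p\<close>,
      and \<open>R\<close> the slow variation of \<open>s i m / m\<close>.\<close>
    define X where "X = z j ^ m * ((of_nat m * \<rho> j m - of_real p) * h m + of_real p * g m) / of_nat m"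
    define R where "R i = s i (Suc m) / of_nat (Suc m) - s i m / of_nat m" for i
    have X_le: "cmod X \<le> (1 / m) * (e m * (y m + t m) + p * y m)"
    proof -
      have "cmod ((of_nat m * \<rho> j m - of_real p) * h m + of_real p * g m) \<le> e m * (y m + t m) + p * y m"
      proof (rule norm_triangle_le, rule add_mono)
        show "cmod ((of_nat m * \<rho> j m - of_real p) * h m) \<le> e m * (y m + t m)"
          unfolding norm_mult by (intro mult_mono e_le j h_le e0) auto
        show "cmod (of_real p * g m) \<le> p * y m" using p0 by (simp add: norm_mult y_def)
      qed
      then show ?thesis
        unfolding X_def using unit[OF j] m0 by (simp add: norm_mult norm_divide norm_power divide_right_mono)
    qed
    have R_le: "cmod (R i) \<le> (1 / m) * ((p + 1) / m * (y m + t m) + t m / m)" if i: "i \<in> I" for i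
    proof -
      have "R i = (s i (Suc m) - s i m) / of_nat (Suc m) - s i m / (of_nat m * of_nat (Suc m))"
        using mc unfolding R_def by (simp add: field_simps del: of_nat_Suc) (simp add: algebra_simps)
      also have "cmod \<dots> \<le> cmod (s i (Suc m) - s i m) / Suc m + cmod (s i m) / (real m * Suc m)"
        by (rule order_trans[OF norm_triangle_ineq4]) (simp add: norm_divide norm_mult del: of_nat_Suc)
      also have "\<dots> \<le> ((p + 1) / m * (y m + t m)) / m + t m / (real m * m)"
        using \<Delta>[OF i] s_le[OF i, of m] m0 y0 t0 p0 by (intro add_mono frac_le mult_left_mono) auto
      finally show ?thesis by (simp add: add_divide_distrib)
    qed
    have "V j (Suc m) - of_real (1 - p / m) * V j m =
        X + of_real (p / m) * (V j m - s j m) + of_real p * (\<Sum>i\<in>I - {j}. b i j * \<omega> i j ^ Suc m * R i)"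
    proof -
      have "b i j * \<omega> i j ^ Suc m = b i j * \<omega> i j ^ m + \<omega> i j ^ m" if "i \<in> I - {j}" for i
      proof -
        have "b i j * (\<omega> i j - 1) = 1" using \<omega>_neq[of i j] that j by (simp add: b_def)
        then have b\<omega>: "b i j * \<omega> i j = b i j + 1" by (simp add: algebra_simps)
        have "b i j * \<omega> i j ^ Suc m = (b i j * \<omega> i j) * \<omega> i j ^ m" by (simp add: mult.assoc)
        then show ?thesis unfolding b\<omega> by (simp only: distrib_right mult_1_left)
      qed
      then have "(\<Sum>i\<in>I - {j}. b i j * \<omega> i j ^ Suc m * s i m) =
          (\<Sum>i\<in>I - {j}. b i j * \<omega> i j ^ m * s i m) + (\<Sum>i\<in>I - {j}. \<omega> i j ^ m * s i m)"
        unfolding sum.distrib[symmetric] by (intro sum.cong refl) (simp only: distrib_right)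
      moreover have "(\<Sum>i\<in>I. \<omega> i j ^ m * s i m) = s j m + (\<Sum>i\<in>I - {j}. \<omega> i j ^ m * s i m)"
      proof -
        have "\<omega> j j = 1"
          using complex_norm_square[of "z j"] unit[OF j] by (simp add: \<omega>_def)
        then show ?thesis using sum.remove[OF fin j, of "\<lambda>i. \<omega> i j ^ m * s i m"] by simp
      qed
      moreover have "z j ^ m * (\<Sum>i\<in>I. cnj (z i) ^ m * s i m) = (\<Sum>i\<in>I. \<omega> i j ^ m * s i m)"
        by (simp add: \<omega>_def power_mult_distrib sum_distrib_left mult_ac)
      ultimately have resonance: "(\<Sum>i\<in>I - {j}. b i j * \<omega> i j ^ Suc m * s i m) =
          (\<Sum>i\<in>I - {j}. b i j * \<omega> i j ^ m * s i m) + z j ^ m * (g m - h m) - s j m"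
        by (simp add: h_def)
      have Rsum: "(\<Sum>i\<in>I - {j}. b i j * \<omega> i j ^ Suc m * R i) =
          (\<Sum>i\<in>I - {j}. b i j * \<omega> i j ^ Suc m * s i (Suc m)) / of_nat (Suc m) -
          (\<Sum>i\<in>I - {j}. b i j * \<omega> i j ^ Suc m * s i m) / of_nat m"
        by (simp only: R_def right_diff_distrib sum_subtractf sum_divide_distrib times_divide_eq_right)
      define Q where "Q = (\<Sum>i\<in>I - {j}. b i j * \<omega> i j ^ Suc m * s i (Suc m)) / of_nat (Suc m)"
      define E where "E = (\<Sum>i\<in>I - {j}. b i j * \<omega> i j ^ m * s i m)"
      have V1: "V j (Suc m) = s j m + z j ^ m * \<rho> j m * h m + of_real p * Q"
        unfolding V_def Q_def rec[OF j] h_def by (simp del: of_nat_Suc)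
      have V0: "V j m = s j m + of_real p / of_nat m * E"
        unfolding V_def E_def by simp
      show ?thesis
        unfolding Rsum resonance V1 V0 X_def Q_def[symmetric] E_def[symmetric]
        using mc by (simp add: field_simps)
    qed
    also have "cmod \<dots> \<le> (1 / m) * (e m * (y m + t m) + p * y m) + (p / m) * ((p / m) * (B * t m)) +
        p * (B * ((1 / m) * ((p + 1) / m * (y m + t m) + t m / m)))"
    proof (intro norm_triangle_mono X_le)
      show "cmod (of_real (p / m) * (V j m - s j m)) \<le> (p / m) * ((p / m) * (B * t m))"
        using mult_left_mono[OF V_close[OF j, of m], of "p / m"] p0 by (simp add: norm_mult norm_divide)
      have "cmod (\<Sum>i\<in>I - {j}. b i j * \<omega> i j ^ Suc m * R i) \<le>
          B * ((1 / m) * ((p + 1) / m * (y m + t m) + t m / m))"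
        using R_le p0 y0 t0 by (intro bsum_le j) auto
      then show "cmod (of_real p * (\<Sum>i\<in>I - {j}. b i j * \<omega> i j ^ Suc m * R i)) \<le>
          p * (B * ((1 / m) * ((p + 1) / m * (y m + t m) + t m / m)))"
        unfolding norm_mult norm_of_real using p0 by (intro mult_mono) auto
    qed
    also have "\<dots> = (1 / m) * (\<kappa> m * t m + (e m + p + p * B * (p + 1) / m) * y m)"
      using m0 by (simp add: \<kappa>_def field_simps power2_eq_square)
    also have "\<dots> \<le> (1 / m) * (\<kappa> m * t m + L * y m)"
    proof -
      have "p * B * (p + 1) / m \<le> p * B * (p + 1) / 1"
        using m p0 B0 by (intro divide_left_mono) auto
      then have "e m + p + p * B * (p + 1) / m \<le> L" using e1 by (simp add: L_def)
      then show ?thesis by (intro mult_left_mono add_left_mono mult_right_mono y0) auto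
    qed
    finally show ?thesis .
  qed
  \<comment> \<open>A rate strictly between \<open>1 / 2\<close> and \<open>p\<close>; the error terms use up \<open>p - q\<close>.\<close>
  define q where "q = (p + 1 / 2) / 2"
  have q: "q > 1 / 2" "q < p" using p by (auto simp: q_def)
  have tW: "\<forall>\<^sub>F m in sequentially. t m \<le> 2 * W m"
  proof -
    have "(\<lambda>m. N * (p * B) / real m) \<longlonglongrightarrow> 0" by real_asymp
    then have "\<forall>\<^sub>F m in sequentially. N * (p * B) / real m < 1 / 2" by (rule order_tendstoD(2)) simp
    then show ?thesis
    proof eventually_elim
      case (elim m)
      have "t m \<le> (\<Sum>j\<in>I. cmod (V j m) + (p / m) * (B * t m))"
        unfolding t_def[of m]
      proof (rule sum_mono)
        fix j assume "j \<in> I"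
        from V_close[OF this, of m] show "cmod (s j m) \<le> cmod (V j m) + p / m * (B * (\<Sum>i\<in>I. cmod (s i m)))"
          using norm_triangle_ineq2[of "s j m" "V j m"] by (simp add: norm_minus_commute t_def)
      qed
      also have "\<dots> = W m + (N * (p * B) / m) * t m"
        by (simp add: sum.distrib W_def N_def)
      also have "\<dots> \<le> W m + (1 / 2) * t m"
        using elim t0[of m] by (intro add_left_mono mult_right_mono) auto
      finally show ?case by simp
    qed
  qed
  have \<kappa>_small: "\<forall>\<^sub>F m in sequentially. N * \<kappa> m * 2 < p - q"
  proof -
    have "(\<lambda>m. p\<^sup>2 * B / real m) \<longlonglongrightarrow> 0" "(\<lambda>m. p * B * (p + 2) / real m) \<longlonglongrightarrow> 0"
      by real_asymp+
    from tendsto_add[OF tendsto_add[OF e_lim this(1)] this(2)] have "\<kappa> \<longlonglongrightarrow> 0"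
      by (simp add: \<kappa>_def[abs_def])
    then have "(\<lambda>m. N * \<kappa> m * 2) \<longlonglongrightarrow> N * 0 * 2" by (intro tendsto_intros)
    then show ?thesis by (rule order_tendstoD(2)) (use q in simp)
  qed
  have W_rec: "\<forall>\<^sub>F m in sequentially. W (Suc m) \<le> (1 - q / m) * W m + (N * L) / m * y m"
  proof -
    have "\<forall>\<^sub>F m in sequentially. e m < 1" using e_lim by (rule order_tendstoD(2)) simp
    moreover have "\<forall>\<^sub>F m in sequentially. real m \<ge> p"
      using filterlim_real_sequentially by (simp add: filterlim_at_top)
    ultimately show ?thesis using tW \<kappa>_small eventually_ge_at_top[of 1]
    proof eventually_elim
      case (elim m)
      have m0: "real m > 0" using elim by simp
      have \<kappa>0: "\<kappa> m \<ge> 0" unfolding \<kappa>_def using e0 p0 B0 by auto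
      have "W (Suc m) \<le> (\<Sum>j\<in>I. (1 - p / m) * cmod (V j m) + (1 / m) * (\<kappa> m * t m + L * y m))"
        unfolding W_def
      proof (rule sum_mono)
        fix j assume j: "j \<in> I"
        have "cmod (V j (Suc m)) \<le> cmod (of_real (1 - p / m) * V j m) +
            cmod (V j (Suc m) - of_real (1 - p / m) * V j m)"
          by (rule norm_triangle_sub)
        also have "cmod (of_real (1 - p / m) * V j m) = (1 - p / m) * cmod (V j m)"
          using elim m0 unfolding norm_mult norm_of_real by simp
        finally show "cmod (V j (Suc m)) \<le> (1 - p / m) * cmod (V j m) + (1 / m) * (\<kappa> m * t m + L * y m)"
          using step[OF j, of m] elim by simp
      qed
      also have "\<dots> = (1 - p / m) * W m + (N / m) * (\<kappa> m * t m + L * y m)"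
        by (simp add: sum.distrib W_def N_def sum_distrib_left)
      also have "\<dots> \<le> (1 - p / m) * W m + (N / m) * (\<kappa> m * (2 * W m) + L * y m)"
        using elim N0 \<kappa>0 by (intro add_left_mono mult_left_mono add_right_mono) auto
      also have "\<dots> = (1 - p / m) * W m + (1 / m) * ((N * \<kappa> m * 2) * W m) + (N * L) / m * y m"
        by (simp add: algebra_simps)
      also have "\<dots> \<le> (1 - p / m) * W m + (1 / m) * ((p - q) * W m) + (N * L) / m * y m"
        using elim W0[of m] by (intro add_left_mono add_right_mono mult_left_mono mult_right_mono) auto
      also have "\<dots> = (1 - q / m) * W m + (N * L) / m * y m"
        using m0 by (simp add: field_simps)
      finally show ?case .
    qed
  qed
  have "summable (\<lambda>m. (W m)\<^sup>2)"
    by (rule weighted_decay_summable[OF q(1) W0 W_rec]) (use g in \<open>simp add: y_def\<close>)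
  then have "summable (\<lambda>m. (2 * W m)\<^sup>2)" unfolding power_mult_distrib by (rule summable_mult)
  moreover have "\<forall>\<^sub>F m in sequentially. cmod (s j m) \<le> 2 * W m"
    using tW by eventually_elim (use s_le[OF \<open>j \<in> I\<close>] in \<open>auto intro: order_trans\<close>)
  ultimately show ?thesis by (rule ell2_le[rotated])
qed

section \<open>Every function divisible by the polynomial lies in the space\<close>

context kernel_basis
begin

text \<open>The equation \<open>quotient_coeff \<alpha> m = g m\<close> expresses \<open>\<alpha> m\<close> by \<open>g m\<close> and the earlier \<open>\<alpha> n\<close>. The recursion is
run on the normalised partial values \<open>s m j\<close>, for which it is the system of
\<open>oscillating_system_ell2\<close>; then \<open>\<alpha> m\<close> differs from \<open>g m\<close> by a combination of
the \<open>s m j\<close> with unimodular coefficients.\<close>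

lemma quotient_coeff_surj:
  assumes p: "p > 1 / 2" and g: "ell2 g"
  obtains \<alpha> where "ell2 \<alpha>" "quotient_coeff \<alpha> = g"
proof -
  define \<rho> where "\<rho> j m = phi J z (a m * z j) / cofactor j (z j)" for j m
  define \<beta> where "\<beta> m v = g m - (\<Sum>i=1..J. cnj (z i) ^ m * v i)" for m and v :: "nat \<Rightarrow> complex"
  define s where "s = rec_nat (\<lambda>j. 0) (\<lambda>m v j. v j + z j ^ m * \<rho> j m * \<beta> m v)"
  have s0: "s 0 j = 0" and sSuc: "s (Suc m) j = s m j + z j ^ m * \<rho> j m * \<beta> m (s m)" for m j
    by (simp_all add: s_def)
  have s: "ell2 (\<lambda>m. s m j)" if "j \<in> {1..J}" for j
  proof (rule oscillating_system_ell2[of "{1..J}" z p \<rho> "\<lambda>j m. s m j" g j])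
    show "(\<lambda>m. of_nat m * \<rho> j m) \<longlonglongrightarrow> complex_of_real p" if "j \<in> {1..J}" for j
      unfolding \<rho>_def by (rule basis_fun_node_limit[OF that])
    show "s (Suc m) j = s m j + z j ^ m * \<rho> j m * (g m - (\<Sum>i\<in>{1..J}. cnj (z i) ^ m * s m i))" for j m
      by (simp add: sSuc \<beta>_def)
  qed (use norm_node inj_node p g that in auto)
  define \<alpha> where "\<alpha> m = \<beta> m (s m)" for m
  have pv: "partial_value \<alpha> j m = cofactor j (z j) * s m j" if j: "j \<in> {1..J}" for j m
  proof (induction m)
    case 0
    show ?case by (simp add: partial_value_def s0)
  next
    case (Suc m)
    have "partial_value \<alpha> j (Suc m) = partial_value \<alpha> j m + \<alpha> m * f m (z j)"
      by (simp add: partial_value_def)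
    then show ?case
      using Suc cofactor_node_nonzero[OF j]
      by (simp add: sSuc \<alpha>_def[symmetric] basis_fun_def \<rho>_def distrib_left mult_ac)
  qed
  show thesis
  proof
    have "ell2 (\<lambda>m. cnj (z i) ^ m * s m i)" if "i \<in> {1..J}" for i
      using s[OF that] norm_node[OF that] by (simp add: norm_mult norm_power)
    then show "ell2 \<alpha>"
      unfolding \<alpha>_def \<beta>_def by (intro ell2_diff ell2_sum g)
    show "quotient_coeff \<alpha> = g"
    proof
      fix m
      have "(\<Sum>j=1..J. cnj (z j) ^ m / cofactor j (z j) * partial_value \<alpha> j m) =
          (\<Sum>j=1..J. cnj (z j) ^ m * s m j)"
        using cofactor_node_nonzero by (intro sum.cong) (auto simp: pv)
      then show "quotient_coeff \<alpha> m = g m"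
        unfolding quotient_coeff_def by (simp add: \<alpha>_def \<beta>_def)
    qed
  qed
qed

lemma sums_add_node_kernels:
  assumes "(\<lambda>n. \<beta> n * f n w) sums u" "cmod w < 1"
  shows "(\<lambda>n. (\<beta> n + (\<Sum>j=1..J. c j * cnj (f n (z j)))) * f n w) sums
    (u + (\<Sum>j=1..J. c j * rkernel f w (z j)))"
proof -
  have "(\<lambda>n. f n w * cnj (f n (z j))) sums rkernel f w (z j)" if "j \<in> {1..J}" for j
  proof -
    have "ell2 (\<lambda>n. cnj (f n (z j)))" using basis_fun_node_ell2[OF that] by simp
    from basis_series_eq_phi_times_quotient[OF this assms(2)]
    have "summable (\<lambda>n. cnj (f n (z j)) * f n w)" by (meson sums_summable)
    then show ?thesis unfolding rkernel_def by (simp add: mult.commute summable_sums)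
  qed
  then have "(\<lambda>n. \<beta> n * f n w + (\<Sum>j=1..J. c j * (f n w * cnj (f n (z j))))) sums
      (u + (\<Sum>j=1..J. c j * rkernel f w (z j)))"
    by (intro sums_add assms(1) sums_sum sums_mult)
  then show ?thesis by (simp add: distrib_left sum_distrib_left mult_ac)
qed

end

section \<open>The description of the space\<close>

theorem corollary13:
  fixes J :: nat and z a :: "nat \<Rightarrow> complex" and p :: real
  assumes "J \<ge> 1"
    and "\<And>j. j \<in> {1..J} \<Longrightarrow> cmod (z j) = 1"
    and "inj_on z {1..J}"
    and "\<And>n. a n \<noteq> 1"
    and "p > 1 / 2"
    and "(\<lambda>n. of_nat n * (1 - a n)) \<longlonglongrightarrow> complex_of_real p"
  shows "(\<lambda>h. restrict h (ball 0 1)) ` rk_space (ball 0 1 \<union> z ` {1..J}) (basis_fun J z a) =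
    {(\<lambda>w\<in>ball 0 1. phi J z w * g w + (\<Sum>j=1..J. c j * rkernel (basis_fun J z a) w (z j)))
      | g (c :: nat \<Rightarrow> complex). g \<in> hardy2}"
    (is "?H = ?R")
proof -
  interpret kernel_basis J z a p
    using assms by unfold_locales auto
  have H: "?H = {(\<lambda>w\<in>ball 0 1. \<Sum>n. \<alpha> n * f n w) | \<alpha>. ell2 \<alpha>}"
  proof -
    have "restrict (restrict F (ball 0 1 \<union> z ` {1..J})) (ball 0 1) = restrict F (ball 0 1)"
      for F :: "complex \<Rightarrow> complex"
      by (auto simp: restrict_def)
    then show ?thesis unfolding rk_space_def setcompr_eq_image image_image by simp
  qed
  show ?thesis unfolding H
  proof (intro equalityI subsetI)
    fix F assume "F \<in> {(\<lambda>w\<in>ball 0 1. \<Sum>n. \<alpha> n * f n w) | \<alpha>. ell2 \<alpha>}"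
    then obtain \<alpha> where \<alpha>: "ell2 \<alpha>" and F: "F = (\<lambda>w\<in>ball 0 1. \<Sum>n. \<alpha> n * f n w)" by auto
    have k: "ell2 (\<lambda>n. cnj (f n (z j)))" if "j \<in> {1..J}" for j
      using basis_fun_node_ell2[OF that] by simp
    obtain c where c: "\<forall>j\<in>{1..J}.
        (\<Sum>n. (\<alpha> n - (\<Sum>i\<in>{1..J}. c i * cnj (f n (z i)))) * cnj (cnj (f n (z j)))) = 0"
      using ell2_projection_exists[of "{1..J}" "\<lambda>j n. cnj (f n (z j))", OF _ k \<alpha>] by auto
    \<comment> \<open>The part of the function that is orthogonal to the kernels, that is, vanishes at the nodes.\<close>
    define \<beta> where "\<beta> n = \<alpha> n - (\<Sum>i=1..J. c i * cnj (f n (z i)))" for n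
    have \<beta>: "ell2 \<beta>" unfolding \<beta>_def by (intro ell2_diff ell2_sum ell2_cmult k \<alpha>)
    have qc: "ell2 (quotient_coeff \<beta>)"
      by (rule quotient_coeff_ell2[OF \<beta>]) (use c in \<open>simp add: \<beta>_def\<close>)
    define g where "g w = (\<Sum>m. quotient_coeff \<beta> m * w ^ m)" for w
    have g: "(\<lambda>m. quotient_coeff \<beta> m * w ^ m) sums g w" if "cmod w < 1" for w
      unfolding g_def by (intro summable_sums summable_power_series_Bseq ell2_imp_Bseq qc that)
    have "(\<Sum>n. \<alpha> n * f n w) = phi J z w * g w + (\<Sum>j=1..J. c j * rkernel f w (z j))"
      if w: "cmod w < 1" for w
    proof -
      obtain \<gamma> where "(\<lambda>m. quotient_coeff \<beta> m * w ^ m) sums \<gamma>" "(\<lambda>n. \<beta> n * f n w) sums (phi J z w * \<gamma>)"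
        using basis_series_eq_phi_times_quotient[OF \<beta> w] by blast
      then have "(\<lambda>n. \<beta> n * f n w) sums (phi J z w * g w)"
        using sums_unique2[OF g[OF w]] by blast
      from sums_unique[OF sums_add_node_kernels[OF this w, of c]]
      show ?thesis by (simp add: \<beta>_def)
    qed
    moreover have "g \<in> hardy2" using qc g by (rule ell2_power_series_in_hardy2)
    ultimately show "F \<in> ?R" unfolding F by (auto intro!: exI[of _ g] exI[of _ c] restrict_ext)
  next
    fix F assume "F \<in> ?R"
    then obtain g c where "g \<in> hardy2" and
      F: "F = (\<lambda>w\<in>ball 0 1. phi J z w * g w + (\<Sum>j=1..J. c j * rkernel f w (z j)))" by auto
    obtain \<gamma> where \<gamma>: "ell2 \<gamma>" and g: "\<And>w. cmod w < 1 \<Longrightarrow> (\<lambda>n. \<gamma> n * w ^ n) sums g w"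
      using hardy2_taylor_ell2[OF \<open>g \<in> hardy2\<close>] by blast
    obtain \<beta> where \<beta>: "ell2 \<beta>" and q: "quotient_coeff \<beta> = \<gamma>"
      using quotient_coeff_surj[OF \<open>p > 1 / 2\<close> \<gamma>] by blast
    define \<alpha> where "\<alpha> n = \<beta> n + (\<Sum>j=1..J. c j * cnj (f n (z j)))" for n
    have "ell2 \<alpha>" unfolding \<alpha>_def
      using basis_fun_node_ell2 by (intro ell2_add ell2_sum ell2_cmult \<beta>) simp
    moreover have "(\<Sum>n. \<alpha> n * f n w) = phi J z w * g w + (\<Sum>j=1..J. c j * rkernel f w (z j))"
      if w: "cmod w < 1" for w
    proof -
      obtain \<gamma>' where "(\<lambda>m. quotient_coeff \<beta> m * w ^ m) sums \<gamma>'" "(\<lambda>n. \<beta> n * f n w) sums (phi J z w * \<gamma>')"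
        using basis_series_eq_phi_times_quotient[OF \<beta> w] by blast
      then have "(\<lambda>n. \<beta> n * f n w) sums (phi J z w * g w)"
        using sums_unique2[OF g[OF w]] unfolding q by blast
      from sums_unique[OF sums_add_node_kernels[OF this w, of c]]
      show ?thesis by (simp add: \<alpha>_def)
    qed
    ultimately show "F \<in> {(\<lambda>w\<in>ball 0 1. \<Sum>n. \<alpha> n * f n w) | \<alpha>. ell2 \<alpha>}"
      unfolding F by (auto intro!: exI[of _ \<alpha>] restrict_ext)
  qed
qed

end
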